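(* Let $I$ be a compact interval, $\beta>1$, and let $f:I\to\mathcal{K}_c(\mathbb{R})$ be continuous with $\dim_H\mathcal{G}_*(f)\ge\beta$. Then there exist $g_*,h_*\in\mathcal{D}_\beta$ such that $f=g_*\oplus h_*$, where $\mathcal{D}_\beta=\{g\in\mathcal{C}(I,\mathcal{K}_c(\mathbb{R})):\dim_H\mathcal{G}_*(g)=\beta\}$.
   Context: $\mathcal{K}_c(\mathbb{R})$: non-empty compact convex subsets of $\mathbb{R}$; $\mathcal{C}(I,\mathcal{K}_c(\mathbb{R}))$: continuous maps $I\to\mathcal{K}_c(\mathbb{R})$ with respect to the Hausdorff distance $\mathfrak{H}$. $(g\oplus h)(x)=g(x)\oplus h(x)$ where $A\oplus B=\{a+b:(a,b)\in\Lambda(A,B)\}$, $\Lambda(A,B)=\{(a,b)\in A\times B:a\in\Lambda_A(b)\text{ or }b\in\Lambda_B(a)\}$, $\Lambda_A(b)=\{a\in A:|b-a|=\min_{a'\in A}|b-a'|\}$. $\mathcal{G}_*(g)=\{(x,g(x)):x\in I\}$ with metric $d((x,Y),(y,Z))=|x-y|+\mathfrak{H}(Y,Z)$; $\dim_H$ is Hausdorff dimension. *)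

theory Defs
  imports "HOL-Analysis.Analysis"
begin

definition Kc :: "real set set" where
  "Kc = {A. A \<noteq> {} \<and> compact A \<and> convex A}"

definition hausdorff_dist :: "real set \<Rightarrow> real set \<Rightarrow> real" where
  "hausdorff_dist A B = max (SUP a\<in>A. infdist a B) (SUP b\<in>B. infdist b A)"

definition cont_Kc :: "real set \<Rightarrow> (real \<Rightarrow> real set) \<Rightarrow> bool" where
  "cont_Kc I g \<longleftrightarrow> (\<forall>x\<in>I. g x \<in> Kc) \<and>
     (\<forall>x\<in>I. \<forall>e>0. \<exists>d>0. \<forall>y\<in>I. \<bar>y - x\<bar> < d \<longrightarrow> hausdorff_dist (g y) (g x) < e)"

definition nearest :: "real set \<Rightarrow> real \<Rightarrow> real set" where
  "nearest A b = {a\<in>A. \<bar>b - a\<bar> = (INF a'\<in>A. \<bar>b - a'\<bar>)}"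

definition Lambda_pairs :: "real set \<Rightarrow> real set \<Rightarrow> (real \<times> real) set" where
  "Lambda_pairs A B = {(a, b). a \<in> A \<and> b \<in> B \<and> (a \<in> nearest A b \<or> b \<in> nearest B a)}"

definition ksum :: "real set \<Rightarrow> real set \<Rightarrow> real set" where
  "ksum A B = {a + b | a b. (a, b) \<in> Lambda_pairs A B}"

definition diam_d :: "('a \<Rightarrow> 'a \<Rightarrow> real) \<Rightarrow> 'a set \<Rightarrow> ennreal" where
  "diam_d d U = (SUP (x, y)\<in>U \<times> U. ennreal (d x y))"

definition hausdorff_content :: "('a \<Rightarrow> 'a \<Rightarrow> real) \<Rightarrow> real \<Rightarrow> real \<Rightarrow> 'a set \<Rightarrow> ennreal" where
  "hausdorff_content d s \<delta> A =
     (INF U\<in>{U :: nat \<Rightarrow> 'a set. A \<subseteq> (\<Union>i. U i) \<and> (\<forall>i. diam_d d (U i) \<le> ennreal \<delta>)}.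
        (\<Sum>i. ennreal (enn2real (diam_d d (U i)) powr s)))"

definition hausdorff_measure :: "('a \<Rightarrow> 'a \<Rightarrow> real) \<Rightarrow> real \<Rightarrow> 'a set \<Rightarrow> ennreal" where
  "hausdorff_measure d s A = (SUP \<delta>\<in>{0<..}. hausdorff_content d s \<delta> A)"

definition hausdorff_dim :: "('a \<Rightarrow> 'a \<Rightarrow> real) \<Rightarrow> 'a set \<Rightarrow> ereal" where
  "hausdorff_dim d A = Inf {ereal s | s. s \<ge> 0 \<and> hausdorff_measure d s A = 0}"

definition graph_metric :: "real \<times> real set \<Rightarrow> real \<times> real set \<Rightarrow> real" where
  "graph_metric p q = \<bar>fst p - fst q\<bar> + hausdorff_dist (snd p) (snd q)"

definition graph_star :: "real set \<Rightarrow> (real \<Rightarrow> real set) \<Rightarrow> (real \<times> real set) set" where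
  "graph_star I g = {(x, g x) | x. x \<in> I}"

definition D_beta :: "real set \<Rightarrow> real \<Rightarrow> (real \<Rightarrow> real set) set" where
  "D_beta I \<beta> = {g. cont_Kc I g \<and> hausdorff_dim graph_metric (graph_star I g) = ereal \<beta>}"

end

theory Submission
  imports Defs
begin

text \<open>
  A value in \<open>Kc\<close> is an interval, the Hausdorff distance of two intervals is the maximum of the
  distances of their endpoints, and the metric sum of two intervals is their Minkowski sum. So
  \<open>f = {l..l + w}\<close> has to be split as \<open>l = g1 + h1\<close>, \<open>w = g2 + h2\<close> with \<open>g2, h2 \<ge> 0\<close>.

  Choose a closed set \<open>K\<close> over which the graph of \<open>f\<close> has dimension exactly \<open>\<beta>\<close> (a Besicovitch-type
  subset theorem) and require \<open>g = h = f/2\<close> on \<open>K\<close>. Off \<open>K\<close>, let \<open>g\<close> be the uniform limit of a sequence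
  in which \<open>g\<close> and \<open>h = f - g\<close> are replaced alternately by Lipschitz functions, each step being tiny
  compared with the Lipschitz constants of the previous ones. Both graphs off \<open>K\<close> then have
  \<open>\<beta>\<close>-dimensional measure zero for every \<open>\<beta> > 1\<close>. Approximating from below by Lipschitz functions
  preserves \<open>g2, h2 \<ge> 0\<close>.
\<close>

subsection \<open>Null sets of Hausdorff measures\<close>

text \<open>The obstacle: a Lipschitz g leaves all the roughness of f in h = f - g, so the two
  summands cannot both be made Lipschitz off K. What is asked of a summand is therefore only
  \<open>thin e\<close>, a condition at one scale: N pieces of size d with N * d^\<beta> \<le> e. It
  survives small uniform perturbations. A Lipschitz function has pieces of size O(1/N), and N *
  N^(-\<beta>) tends to 0 for \<beta> > 1, so thin pairs are also found near every admissible one.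
  The construction is thus a Baire category argument with nested balls, the n-th consisting of pairs
  for which both summands are thin at 1/(n+1). K is needed because the graph of f may have dimension
  above \<beta>. Halving f on K gives both summands the right dimension at once, since f and f/2
  have bi-Lipschitz graphs. Hausdorff measures enter only through being zero or not. This allows the
  subset theorem to be proved on the finite levels of a dyadic tree, with finite sets of nodes as
  covers.\<close>

lemma ennreal_le_suminf: "f i \<le> (\<Sum>i. f i)" for f :: "nat \<Rightarrow> ennreal"
proof -
  have "sum f {i} \<le> (\<Sum>i. f i)" by (rule sum_le_suminf) auto
  then show ?thesis by simp
qed

text \<open>The mesh bound \<delta> comes for free: a total weight of at most \<delta> powr s forces
  every w i \<le> \<delta>. Hence nullity can be tested by covers of small weight alone, with
  majorants w i in place of diameters.\<close>

lemma hausdorff_measure_eq_0I: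
  assumes s: "s > 0"
    and cov: "\<And>e. e > 0 \<Longrightarrow> \<exists>U w. A \<subseteq> (\<Union>i::nat. U i) \<and> (\<forall>i. w i \<ge> 0) \<and>
        (\<forall>i. \<forall>x\<in>U i. \<forall>y\<in>U i. d x y \<le> w i) \<and> (\<Sum>i. ennreal (w i powr s)) \<le> ennreal e"
  shows "hausdorff_measure d s A = 0"
proof -
  have "hausdorff_content d s \<delta> A \<le> 0" if \<delta>: "\<delta> > 0" for \<delta>
  proof (rule ennreal_le_epsilon)
    fix e :: real assume e: "e > 0"
    define e' where "e' = min e (\<delta> powr s)"
    have "e' > 0" using e \<delta> by (simp add: e'_def)
    from cov[OF this] obtain U w where U: "A \<subseteq> (\<Union>i::nat. U i)" "\<And>i. w i \<ge> 0"
        "\<And>i x y. x \<in> U i \<Longrightarrow> y \<in> U i \<Longrightarrow> d x y \<le> w i"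
        "(\<Sum>i. ennreal (w i powr s)) \<le> ennreal e'" by blast
    have diam: "diam_d d (U i) \<le> ennreal (w i)" for i
      unfolding diam_d_def by (rule SUP_least) (auto intro!: ennreal_leI U(3))
    have term_le: "ennreal (w i powr s) \<le> ennreal e'" for i
    proof -
      have "ennreal (w i powr s) \<le> (\<Sum>i. ennreal (w i powr s))"
        by (rule ennreal_le_suminf)
      then show ?thesis using U(4) by (rule order_trans)
    qed
    have w\<delta>: "w i \<le> \<delta>" for i
    proof -
      have "w i powr s \<le> \<delta> powr s" using term_le[of i] \<open>e' > 0\<close> by (simp add: e'_def)
      then show ?thesis using s U(2)[of i] \<delta>
        by (meson less_eq_real_def not_less powr_less_mono2)
    qed
    have diam\<delta>: "diam_d d (U i) \<le> ennreal \<delta>" for i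
      using diam[of i] w\<delta>[of i] by (meson ennreal_leI order_trans)
    have "hausdorff_content d s \<delta> A \<le> (\<Sum>i. ennreal (enn2real (diam_d d (U i)) powr s))"
      unfolding hausdorff_content_def by (rule INF_lower) (use U(1) diam\<delta> in auto)
    also have "\<dots> \<le> (\<Sum>i. ennreal (w i powr s))"
    proof (intro suminf_le ennreal_leI powr_mono2)
      show "enn2real (diam_d d (U i)) \<le> w i" for i
        using diam[of i] U(2)[of i] enn2real_mono[OF diam[of i]] by simp
    qed (use s in auto)
    also have "\<dots> \<le> ennreal e" using U(4) by (rule order_trans) (simp add: e'_def ennreal_leI)
    finally show "hausdorff_content d s \<delta> A \<le> 0 + ennreal e" by simp
  qed
  then show ?thesis unfolding hausdorff_measure_def by (auto intro!: antisym SUP_least)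
qed

text \<open>Later covers are indexed by tree nodes or grid cells, hence the arbitrary index type.
  Padding with {} and w = 0 costs nothing, as 0 powr s = 0.\<close>

lemma hausdorff_measure_eq_0I_finite:
  assumes s: "s > 0"
    and cov: "\<And>e. e > 0 \<Longrightarrow> \<exists>(J::'j set) U w. finite J \<and> A \<subseteq> (\<Union>j\<in>J. U j) \<and> (\<forall>j\<in>J. w j \<ge> 0) \<and>
        (\<forall>j\<in>J. \<forall>x\<in>U j. \<forall>y\<in>U j. d x y \<le> w j) \<and> (\<Sum>j\<in>J. w j powr s) \<le> e"
  shows "hausdorff_measure d s A = 0"
proof (rule hausdorff_measure_eq_0I[OF s])
  fix e :: real assume "e > 0"
  from cov[OF this] obtain J :: "'j set" and U w where J: "finite J" "A \<subseteq> (\<Union>j\<in>J. U j)" "\<forall>j\<in>J. w j \<ge> 0"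
      "\<forall>j\<in>J. \<forall>x\<in>U j. \<forall>y\<in>U j. d x y \<le> w j" "(\<Sum>j\<in>J. w j powr s) \<le> e" by blast
  from ex_bij_betw_nat_finite[OF J(1)] obtain h where h: "bij_betw h {0..<card J} J" by blast
  let ?n = "card J"
  have hJ: "h i \<in> J" if "i < ?n" for i using h that by (auto simp: bij_betw_def)
  define U' where "U' i = (if i < ?n then U (h i) else {})" for i
  define w' where "w' i = (if i < ?n then w (h i) else 0)" for i
  have "A \<subseteq> (\<Union>i. U' i)"
  proof
    fix x assume "x \<in> A"
    then obtain j where j: "j \<in> J" "x \<in> U j" using J(2) by blast
    then obtain i where "i < ?n" "h i = j" using h unfolding bij_betw_def by (metis atLeastLessThan_iff imageE)
    then show "x \<in> (\<Union>i. U' i)" using j by (auto simp: U'_def intro!: exI[of _ i])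
  qed
  moreover have "(\<Sum>i. ennreal (w' i powr s)) \<le> ennreal e"
  proof -
    have "(\<Sum>i. ennreal (w' i powr s)) = (\<Sum>i\<in>{0..<?n}. ennreal (w' i powr s))"
      by (rule suminf_finite) (auto simp: w'_def)
    also have "\<dots> = ennreal (\<Sum>i\<in>{0..<?n}. w' i powr s)" by (simp add: sum_ennreal)
    also have "(\<Sum>i\<in>{0..<?n}. w' i powr s) = (\<Sum>i\<in>{0..<?n}. w (h i) powr s)"
      by (rule sum.cong) (auto simp: w'_def)
    also have "\<dots> = (\<Sum>j\<in>J. w j powr s)"
      using sum.reindex_bij_betw[OF h, of "\<lambda>j. w j powr s"] by simp
    finally show ?thesis using J(5) by (simp add: ennreal_leI)
  qed
  moreover have "\<forall>i. w' i \<ge> 0" "\<forall>i. \<forall>x\<in>U' i. \<forall>y\<in>U' i. d x y \<le> w' i"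
    using J(3,4) hJ by (auto simp: w'_def U'_def)
  ultimately show "\<exists>U w. A \<subseteq> (\<Union>i::nat. U i) \<and> (\<forall>i. w i \<ge> 0) \<and>
        (\<forall>i. \<forall>x\<in>U i. \<forall>y\<in>U i. d x y \<le> w i) \<and> (\<Sum>i. ennreal (w i powr s)) \<le> ennreal e"
    by blast
qed

lemma hausdorff_measure_eq_0_iff_content:
  "hausdorff_measure d s A = 0 \<longleftrightarrow> (\<forall>\<delta>>0. hausdorff_content d s \<delta> A = 0)"
  unfolding hausdorff_measure_def by (auto simp: SUP_eq_iff bot_ennreal[symmetric])

text \<open>The strict bounds are the point: they allow pieces to be enlarged to open sets of radius
  w i, and give even a single point a positive size with a dyadic level.\<close>

lemma hausdorff_measure_eq_0D:
  assumes s: "s > 0" and null: "hausdorff_measure d s A = 0" and e: "e > 0"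
  obtains U w where "A \<subseteq> (\<Union>i::nat. U i)" "\<And>i. w i > 0"
    "\<And>i x y. x \<in> U i \<Longrightarrow> y \<in> U i \<Longrightarrow> d x y < w i" "(\<Sum>i. ennreal (w i powr s)) \<le> ennreal e"
proof -
  have "hausdorff_content d s 1 A < ennreal (e/2)"
    using null e by (simp add: hausdorff_measure_eq_0_iff_content)
  then obtain U where U: "A \<subseteq> (\<Union>i. U i)" "\<And>i. diam_d d (U i) \<le> ennreal 1"
      "(\<Sum>i. ennreal (enn2real (diam_d d (U i)) powr s)) < ennreal (e/2)"
    unfolding hausdorff_content_def INF_less_iff by auto
  define D where "D i = enn2real (diam_d d (U i))" for i
  have D: "d x y \<le> D i" if "x \<in> U i" "y \<in> U i" for x y i
  proof -
    have "ennreal (d x y) \<le> diam_d d (U i)"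
      unfolding diam_d_def by (rule SUP_upper2[of "(x,y)"]) (use that in auto)
    also have "\<dots> = ennreal (D i)"
      unfolding D_def using U(2)[of i] by (intro ennreal_enn2real[symmetric]) (auto intro: le_less_trans)
    finally show ?thesis by (simp add: D_def ennreal_le_iff)
  qed
  \<comment> \<open>The summand e * (1/2)^(i+2) makes the s-th power strictly larger than that of
    the diameter; these summands total e/2, the half left over by the cover U.\<close>
  define t where "t i = D i powr s + e * (1/2)^(i+2)" for i
  define w where "w i = t i powr (1/s)" for i
  have D0: "D i \<ge> 0" for i by (simp add: D_def)
  have tpos: "t i > 0" for i using e by (auto simp: t_def intro!: add_nonneg_pos)
  have ws: "w i powr s = t i" for i using tpos[of i] s by (simp add: w_def powr_powr)
  have Dw: "D i < w i" for i
  proof -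
    have "D i powr s < w i powr s" using e by (simp add: ws) (simp add: t_def)
    then show ?thesis using s tpos[of i]
      by (smt (verit) D0 powr_mono2 powr_ge_zero w_def)
  qed
  have "(\<Sum>i. ennreal (w i powr s)) = (\<Sum>i. ennreal (D i powr s) + ennreal (e * (1/2)^(i+2)))"
    unfolding ws t_def using e by (intro suminf_cong ennreal_plus) auto
  also have "\<dots> = (\<Sum>i. ennreal (D i powr s)) + (\<Sum>i. ennreal (e * (1/2)^(i+2)))"
    by (rule suminf_add[symmetric]) auto
  also have "(\<Sum>i. ennreal (e * (1/2)^(i+2))) = ennreal (e/2)"
  proof (rule suminf_ennreal_eq)
    have "(\<lambda>i. (e/4) * (1/2)^i) sums ((e/4) * (1 / (1 - 1/2)))"
      by (intro sums_mult geometric_sums) auto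
    then show "(\<lambda>i. e * (1/2)^(i+2)) sums (e/2)" by (simp add: field_simps)
  qed (use e in auto)
  also have "(\<Sum>i. ennreal (D i powr s)) + ennreal (e/2) \<le> ennreal (e/2) + ennreal (e/2)"
    using U(3) by (intro add_mono) (auto simp: D_def less_imp_le)
  also have "\<dots> = ennreal e" using e by (simp add: ennreal_plus[symmetric] del: ennreal_plus)
  finally have "(\<Sum>i. ennreal (w i powr s)) \<le> ennreal e" .
  moreover have "d x y < w i" if "x \<in> U i" "y \<in> U i" for x y i
    using D[OF that] Dw[of i] by simp
  moreover have "w i > 0" for i using D0[of i] Dw[of i] by simp
  ultimately show thesis using that[OF U(1)] by blast
qed

lemma hausdorff_measure_null_mono_exponent:
  assumes "0 \<le> s" "s \<le> t" and null: "hausdorff_measure d s A = 0"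
  shows "hausdorff_measure d t A = 0"
  unfolding hausdorff_measure_eq_0_iff_content
proof (intro allI impI)
  fix \<delta> :: real assume "\<delta> > 0"
  \<comment> \<open>For pieces of diameter at most 1 the t-th power is below the s-th power.\<close>
  define \<delta>' where "\<delta>' = min \<delta> 1"
  have \<delta>': "\<delta>' > 0" "\<delta>' \<le> \<delta>" "\<delta>' \<le> 1" using \<open>\<delta> > 0\<close> by (auto simp: \<delta>'_def)
  have "hausdorff_content d t \<delta> A \<le> hausdorff_content d s \<delta>' A"
    unfolding hausdorff_content_def
  proof (rule INF_mono, clarify)
    fix U :: "nat \<Rightarrow> 'a set"
    assume U: "A \<subseteq> (\<Union>i. U i)" "\<forall>i. diam_d d (U i) \<le> ennreal \<delta>'"
    have "enn2real (diam_d d (U i)) powr t \<le> enn2real (diam_d d (U i)) powr s" for i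
    proof (rule powr_mono')
      show "enn2real (diam_d d (U i)) \<le> 1"
        using enn2real_mono[of "diam_d d (U i)" "ennreal \<delta>'"] U(2) \<delta>' by auto
    qed (use assms in auto)
    then show "\<exists>V\<in>{U. A \<subseteq> \<Union> (range U) \<and> (\<forall>i. diam_d d (U i) \<le> ennreal \<delta>)}.
        (\<Sum>i. ennreal (enn2real (diam_d d (V i)) powr t)) \<le> (\<Sum>i. ennreal (enn2real (diam_d d (U i)) powr s))"
      using U \<delta>' by (intro bexI[of _ U] suminf_le ennreal_leI)
        (auto intro: order_trans[OF _ ennreal_leI[OF \<delta>'(2)]])
  qed
  also have "\<dots> = 0" using null \<delta>'(1) by (simp add: hausdorff_measure_eq_0_iff_content)
  finally show "hausdorff_content d t \<delta> A = 0" by simp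
qed

lemma hausdorff_measure_null_subset:
  assumes "A \<subseteq> B" "hausdorff_measure d s B = 0"
  shows "hausdorff_measure d s A = 0"
proof -
  have "hausdorff_content d s \<delta> A \<le> hausdorff_content d s \<delta> B" for \<delta>
    unfolding hausdorff_content_def by (rule INF_superset_mono) (use assms(1) in auto)
  then show ?thesis using assms(2) by (simp add: hausdorff_measure_eq_0_iff_content) (metis le_zero_eq)
qed

lemma hausdorff_measure_null_UN:
  fixes A :: "nat \<Rightarrow> 'a set"
  assumes s: "s > 0" and null: "\<And>n. hausdorff_measure d s (A n) = 0"
  shows "hausdorff_measure d s (\<Union>n. A n) = 0"
proof (rule hausdorff_measure_eq_0I[OF s])
  fix e :: real assume e: "e > 0"
  have "\<exists>U w. A n \<subseteq> (\<Union>i::nat. U i) \<and> (\<forall>i. w i > 0) \<and>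
    (\<forall>i. \<forall>x \<in> U i. \<forall> y \<in> U i. d x y < w i) \<and> (\<Sum>i. ennreal (w i powr s)) \<le> ennreal (e * (1/2)^(n+1))" for n
    by (rule hausdorff_measure_eq_0D[OF s null[of n], of "e * (1/2)^(n+1)"]) (use e in auto, blast)
  then obtain U w where U: "\<And>n. A n \<subseteq> (\<Union>i::nat. U n i)" "\<And>n i. w n i > 0"
    "\<And>n i x y. x \<in> U n i \<Longrightarrow> y \<in> U n i \<Longrightarrow> d x y < w n i"
    "\<And>n. (\<Sum>i. ennreal (w n i powr s)) \<le> ennreal (e * (1/2)^(n+1))" by metis
  define U' where "U' k = (case prod_decode k of (n,i) \<Rightarrow> U n i)" for k
  define w' where "w' k = (case prod_decode k of (n,i) \<Rightarrow> w n i)" for k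
  have "(\<Union>n. A n) \<subseteq> (\<Union>k. U' k)"
  proof
    fix x assume "x \<in> (\<Union>n. A n)"
    then obtain n i where "x \<in> U n i" using U(1) by blast
    then have "x \<in> U' (prod_encode (n,i))" by (simp add: U'_def)
    then show "x \<in> (\<Union>k. U' k)" by blast
  qed
  moreover have "(\<Sum>k. ennreal (w' k powr s)) \<le> ennreal e"
  proof -
    have "(\<Sum>k. ennreal (w' k powr s)) = (\<Sum>n. \<Sum>i. ennreal (w n i powr s))"
      unfolding w'_def case_prod_beta
      by (subst suminf_ennreal_2dimen[symmetric,
            where f = "\<lambda>p. ennreal (w (fst p) (snd p) powr s)"]) auto
    also have "\<dots> \<le> (\<Sum>n. ennreal (e * (1/2)^(n+1)))" by (intro suminf_le U(4)) auto
    also have "\<dots> = ennreal e"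
    proof (rule suminf_ennreal_eq)
      have "(\<lambda>i. (e/2) * (1/2)^i) sums ((e/2) * (1 / (1 - 1/2)))"
        by (intro sums_mult geometric_sums) auto
      then show "(\<lambda>i. e * (1/2)^(i+1)) sums e" by (simp add: field_simps)
    qed (use e in auto)
    finally show ?thesis .
  qed
  moreover have "\<forall>k. w' k \<ge> 0" "\<forall>k. \<forall>x\<in>U' k. \<forall>y\<in>U' k. d x y \<le> w' k"
    using U(2,3) by (auto simp: w'_def U'_def less_imp_le split: prod.splits)
  ultimately show "\<exists>U w. (\<Union>n. A n) \<subseteq> (\<Union>i::nat. U i) \<and> (\<forall>i. w i \<ge> 0) \<and>
        (\<forall>i. \<forall>x\<in>U i. \<forall>y\<in>U i. d x y \<le> w i) \<and> (\<Sum>i. ennreal (w i powr s)) \<le> ennreal e"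
    by blast
qed

lemma hausdorff_measure_null_Un:
  assumes "s > 0" "hausdorff_measure d s A = 0" "hausdorff_measure d s B = 0"
  shows "hausdorff_measure d s (A \<union> B) = 0"
proof (rule hausdorff_measure_null_subset)
  show "hausdorff_measure d s (\<Union>n. if n = (0::nat) then A else B) = 0"
    by (rule hausdorff_measure_null_UN) (use assms in auto)
  show "A \<union> B \<subseteq> (\<Union>n. if n = (0::nat) then A else B)"
    using UN_upper[of 0 UNIV "\<lambda>n::nat. if n = 0 then A else B"]
      UN_upper[of 1 UNIV "\<lambda>n::nat. if n = 0 then A else B"] by auto
qed

lemma hausdorff_measure_null_Lipschitz_image:
  assumes s: "s > 0" and "L \<ge> 0" and null: "hausdorff_measure d s A = 0"
    and Lip: "\<And>x y. x \<in> A \<Longrightarrow> y \<in> A \<Longrightarrow> d' (\<phi> x) (\<phi> y) \<le> L * d x y"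
  shows "hausdorff_measure d' s (\<phi> ` A) = 0"
proof (rule hausdorff_measure_eq_0I[OF s])
  fix e :: real assume e: "e > 0"
  \<comment> \<open>Positive even for L = 0, where e / L powr s would be 0 by convention.\<close>
  define M where "M = L + 1"
  have M: "M > 0" "L \<le> M" using \<open>L \<ge> 0\<close> by (auto simp: M_def)
  have "e / M powr s > 0" using e M by simp
  then obtain U w where U: "A \<subseteq> (\<Union>i::nat. U i)" "\<And>i. w i > 0"
    "\<And>i x y. x \<in> U i \<Longrightarrow> y \<in> U i \<Longrightarrow> d x y < w i" "(\<Sum>i. ennreal (w i powr s)) \<le> ennreal (e / M powr s)"
    by (rule hausdorff_measure_eq_0D[OF s null]) (rule that)
  have "\<phi> ` A \<subseteq> (\<Union>i. \<phi> ` (U i \<inter> A))" using U(1) by blast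
  moreover have "d' (\<phi> x) (\<phi> y) \<le> M * w i" if "x \<in> U i \<inter> A" "y \<in> U i \<inter> A" for x y i
  proof -
    have "d' (\<phi> x) (\<phi> y) \<le> L * d x y" using Lip that by blast
    also have "\<dots> \<le> L * w i" using U(3)[of x i y] that \<open>L \<ge> 0\<close> by (intro mult_left_mono) auto
    also have "\<dots> \<le> M * w i" using U(2)[of i] M by (intro mult_right_mono) auto
    finally show ?thesis .
  qed
  moreover have "(\<Sum>i. ennreal ((M * w i) powr s)) \<le> ennreal e"
  proof -
    have "(\<Sum>i. ennreal ((M * w i) powr s)) = (\<Sum>i. ennreal (M powr s) * ennreal (w i powr s))"
      using M U(2) by (intro suminf_cong) (simp add: powr_mult less_imp_le ennreal_mult)
    also have "\<dots> = ennreal (M powr s) * (\<Sum>i. ennreal (w i powr s))" by simp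
    also have "\<dots> \<le> ennreal (M powr s) * ennreal (e / M powr s)" by (intro mult_left_mono U(4)) auto
    also have "\<dots> = ennreal e" using M e by (simp add: ennreal_mult[symmetric])
    finally show ?thesis .
  qed
  moreover have "M * w i \<ge> 0" for i using M U(2)[of i] by simp
  ultimately show "\<exists>U w. \<phi> ` A \<subseteq> (\<Union>i::nat. U i) \<and> (\<forall>i. w i \<ge> 0) \<and>
        (\<forall>i. \<forall>x\<in>U i. \<forall>y\<in>U i. d' x y \<le> w i) \<and> (\<Sum>i. ennreal (w i powr s)) \<le> ennreal e"
    by (intro exI[of _ "\<lambda>i. \<phi> ` (U i \<inter> A)"] exI[of _ "\<lambda>i. M * w i"]) auto
qed

lemma hausdorff_dim_eqI:
  assumes "\<beta> > 0" and up: "\<And>s. s > \<beta> \<Longrightarrow> hausdorff_measure d s A = 0"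
    and low: "\<And>s. 0 < s \<Longrightarrow> s < \<beta> \<Longrightarrow> hausdorff_measure d s A \<noteq> 0"
  shows "hausdorff_dim d A = ereal \<beta>"
proof (rule antisym)
  show "hausdorff_dim d A \<le> ereal \<beta>"
  proof (rule ereal_le_epsilon2)
    fix e :: real assume "e > 0"
    then show "hausdorff_dim d A \<le> ereal \<beta> + ereal e"
      unfolding hausdorff_dim_def using up[of "\<beta> + e"] \<open>\<beta> > 0\<close> by (intro Inf_lower) auto
  qed
  show "ereal \<beta> \<le> hausdorff_dim d A"
    unfolding hausdorff_dim_def
  proof (rule Inf_greatest, clarify)
    fix s :: real assume s: "s \<ge> 0" "hausdorff_measure d s A = 0"
    show "ereal \<beta> \<le> ereal s"
    proof (rule ccontr)
      assume "\<not> ereal \<beta> \<le> ereal s"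
      then have "s < \<beta>" by simp
      \<comment> \<open>The midpoint replaces s because s may be 0, where \<open>low\<close> says
        nothing.\<close>
      define t where "t = (s + \<beta>) / 2"
      have "hausdorff_measure d t A = 0"
        by (rule hausdorff_measure_null_mono_exponent[OF s(1) _ s(2)]) (use \<open>s < \<beta>\<close> in \<open>simp add: t_def\<close>)
      then show False using low[of t] \<open>s < \<beta>\<close> s(1) by (simp add: t_def)
    qed
  qed
qed

subsection \<open>Minimal subtrees of given content\<close>

text \<open>A pair (k, u) stands for all branches through node u of level k; m is a depth by which
  every branch through A has met S. The level is part of the pair because one map \<open>par\<close>
  serves all levels and a label may occur on several of them.\<close>

definition tree_covers :: "('a \<Rightarrow> 'a) \<Rightarrow> (nat \<times> 'a) set \<Rightarrow> nat \<Rightarrow> 'a set \<Rightarrow> bool" where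
  "tree_covers par S m A \<longleftrightarrow> (\<forall>v\<in>A. \<exists>k\<le>m. (k, (par ^^ (m - k)) v) \<in> S)"

lemma funpow_diff_compose:
  assumes "j \<le> k" "k \<le> (m::nat)"
  shows "(par ^^ (k - j)) ((par ^^ (m - k)) v) = (par ^^ (m - j)) v"
proof -
  have "m - j = (k - j) + (m - k)" using assms by simp
  then show ?thesis by (simp add: funpow_add)
qed

lemma sum_UN_le:
  fixes f :: "'b \<Rightarrow> real"
  assumes "finite I" "\<And>i. i \<in> I \<Longrightarrow> finite (A i)" "\<And>x. f x \<ge> 0"
  shows "sum f (\<Union>i\<in>I. A i) \<le> (\<Sum>i\<in>I. sum f (A i))"
  using assms(1,2)
proof (induction I rule: finite_induct)
  case (insert i I)
  have "sum f (\<Union>i\<in>insert i I. A i) \<le> sum f (A i) + sum f (\<Union>i\<in>I. A i)"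
    using insert assms(3) by (auto simp: sum_Un sum_nonneg)
  then show ?case using insert by auto
qed auto

text \<open>Besicovitch's theorem on subsets of finite measure, for the boundary of a tree: a subtree that
  is minimal among those of content at least \<open>c\<close> cannot be thinned out below any node, so every
  cover can be refined to deeper levels without increasing its weight.\<close>

lemma thin_subtree_exists:
  fixes E :: "nat \<Rightarrow> 'a set" and par :: "'a \<Rightarrow> 'a" and r :: "nat \<Rightarrow> real"
  assumes fin: "\<And>n. finite (E n)"
    and parE: "\<And>n v. v \<in> E (Suc n) \<Longrightarrow> par v \<in> E n"
    and r_pos: "\<And>k. r k > 0" and r_lim: "r \<longlonglongrightarrow> 0"
    and low: "\<And>m S. finite S \<Longrightarrow> tree_covers par S m (E m) \<Longrightarrow> c \<le> (\<Sum>q\<in>S. r (fst q))"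
  obtains T where "\<And>n. T n \<subseteq> E n" "\<And>n v. v \<in> T (Suc n) \<Longrightarrow> par v \<in> T n"
    "\<And>m S. finite S \<Longrightarrow> tree_covers par S m (T m) \<Longrightarrow> c \<le> (\<Sum>q\<in>S. r (fst q))"
    "\<And>n. \<exists>m S. finite S \<and> (\<forall>q\<in>S. n \<le> fst q) \<and> tree_covers par S m (T m) \<and>
        (\<Sum>q\<in>S. r (fst q)) \<le> real (card (E 0)) * r 0 + 1"
proof -
  \<comment> \<open>R is the set of removed nodes and \<open>lev R\<close> the tree that is left. In
    terms of removals a minimal subtree is a maximal element, as Zorn's lemma provides.\<close>
  define lev where "lev R m = E m - {v. (m, v) \<in> R}" for R :: "(nat \<times> 'a) set" and m
  define A where "A = {R. (\<forall>n v. (n, par v) \<in> R \<longrightarrow> v \<in> E (Suc n) \<longrightarrow> (Suc n, v) \<in> R) \<and>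
     (\<forall>m S. finite S \<longrightarrow> tree_covers par S m (lev R m) \<longrightarrow> c \<le> (\<Sum>q\<in>S. r (fst q)))}"
  have Acl: "(Suc n, v) \<in> R" if "R \<in> A" "(n, par v) \<in> R" "v \<in> E (Suc n)" for R n v
    using that unfolding A_def by blast
  have Alow: "c \<le> (\<Sum>q\<in>S. r (fst q))"
    if "R \<in> A" "finite S" "tree_covers par S m (lev R m)" for R S m
    using that unfolding A_def by blast
  have "\<exists>M\<in>A. \<forall>X\<in>A. M \<subseteq> X \<longrightarrow> X = M"
  proof (rule subset_Zorn_nonempty)
    have "{} \<in> A" using low by (auto simp: A_def lev_def)
    then show "A \<noteq> {}" by blast
    fix C assume C: "C \<noteq> {}" "subset.chain A C"
    then have CA: "C \<subseteq> A" by (simp add: subset.chain_def)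
    have "c \<le> (\<Sum>q\<in>S. r (fst q))" if S: "finite S" "tree_covers par S m (lev (\<Union>C) m)" for m S
    proof -
      \<comment> \<open>Level m is finite, so a single member of the chain has already removed
        everything that the union removes there.\<close>
      have "finite (Pair m ` E m \<inter> \<Union>C)" using fin by blast
      then obtain R where R: "R \<in> C" "Pair m ` E m \<inter> \<Union>C \<subseteq> R"
        using finite_subset_Union_chain[OF _ _ C] by (metis Int_lower2)
      then have "lev R m = lev (\<Union>C) m" by (auto simp: lev_def)
      moreover have "R \<in> A" using R(1) CA by blast
      ultimately show ?thesis using Alow[of R S m] S by simp
    qed
    moreover have "(Suc n, v) \<in> \<Union>C" if "(n, par v) \<in> \<Union>C" "v \<in> E (Suc n)" for n v
      using that CA Acl by blast
    ultimately show "\<Union>C \<in> A" by (simp add: A_def)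
  qed
  then obtain R where R: "R \<in> A" and max: "\<And>X. X \<in> A \<Longrightarrow> R \<subseteq> X \<Longrightarrow> X = R" by blast
  define T where "T = lev R"
  have Rcl: "(Suc n, v) \<in> R" if "(n, par v) \<in> R" "v \<in> E (Suc n)" for n v
    using Acl[OF R] that by blast
  have TE: "T n \<subseteq> E n" for n by (auto simp: T_def lev_def)
  have Tpar: "par v \<in> T n" if "v \<in> T (Suc n)" for n v
    using that parE Rcl by (auto simp: T_def lev_def)
  have Tlow: "c \<le> (\<Sum>q\<in>S. r (fst q))" if "finite S" "tree_covers par S m (T m)" for m S
    using Alow[OF R] that unfolding T_def by blast
  have Tanc': "(par ^^ j) v \<in> T k" if "v \<in> T (k + j)" for j k v
    using that
  proof (induction j arbitrary: v)
    case (Suc j)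
    then have "par v \<in> T (k + j)" using Tpar by simp
    then show ?case using Suc.IH by (simp add: funpow_swap1)
  qed simp
  have Tanc: "(par ^^ (m - k)) v \<in> T k" if "v \<in> T m" "k \<le> m" for k m v
    using Tanc'[of v k "m - k"] that by simp
  \<comment> \<open>What minimality gives: a node w can be replaced by nodes strictly below it at an
    extra cost of at most e. Otherwise some light node v0 below w could be removed with all its
    descendants and content c would still remain.\<close>
  have refine: "\<exists>m\<ge>k. \<exists>S. finite S \<and> (\<forall>q\<in>S. k < fst q) \<and>
      tree_covers par S m {v \<in> T m. (par ^^ (m - k)) v = w} \<and> (\<Sum>q\<in>S. r (fst q)) \<le> r k + e"
    if e: "e > 0" for k w and e :: real
  proof (rule ccontr)
    define D where "D m = {v \<in> T m. (par ^^ (m - k)) v = w}" for m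
    assume neg: "\<not> ?thesis"
    have big: "r k + e < (\<Sum>q\<in>S. r (fst q))"
      if "m \<ge> k" "finite S" "\<forall>q\<in>S. k < fst q" "tree_covers par S m (D m)" for m S
    proof (rule ccontr)
      assume "\<not> ?thesis"
      then have "finite S \<and> (\<forall>q\<in>S. k < fst q) \<and> tree_covers par S m {v \<in> T m. (par ^^ (m - k)) v = w} \<and>
          (\<Sum>q\<in>S. r (fst q)) \<le> r k + e"
        using that unfolding D_def by simp
      then show False using neg that(1) by blast
    qed
    have "\<forall>\<^sub>F n in sequentially. r n < e \<and> k < n"
      using order_tendstoD(2)[OF r_lim e] by (intro eventually_conj eventually_gt_at_top)
    then obtain p where p: "r p < e" "k < p"
      unfolding eventually_sequentially by blast
    \<comment> \<open>Without descendants of w on level p the empty cover, of weight 0, would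
      contradict \<open>big\<close>.\<close>
    have "D p \<noteq> {}"
    proof
      assume "D p = {}"
      then have "r k + e < 0" using p big[of p "{}"] by (simp add: tree_covers_def)
      then show False using r_pos[of k] e by simp
    qed
    then obtain v0 where v0: "v0 \<in> T p" "(par ^^ (p - k)) v0 = w" by (auto simp: D_def)
    define X where "X = R \<union> {(n, v). p \<le> n \<and> v \<in> E n \<and> (par ^^ (n - p)) v = v0}"
    have "X \<in> A"
      unfolding A_def
    proof (intro CollectI conjI allI impI)
      fix n v assume nv: "(n, par v) \<in> X" "v \<in> E (Suc n)"
      show "(Suc n, v) \<in> X"
      proof (cases "(n, par v) \<in> R")
        case False
        then have "p \<le> n" "(par ^^ (n - p)) (par v) = v0" using nv by (auto simp: X_def)
        then show ?thesis using nv(2) by (auto simp: X_def Suc_diff_le funpow_swap1)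
      qed (use nv Rcl in \<open>auto simp: X_def\<close>)
    next
      fix m and S :: "(nat \<times> 'a) set" assume S: "finite S" "tree_covers par S m (lev X m)"
      show "c \<le> (\<Sum>q\<in>S. r (fst q))"
      proof (cases "p \<le> m")
        case False
        then have "lev X m = T m" by (auto simp: lev_def X_def T_def)
        then show ?thesis using Tlow S by metis
      next
        case pm: True
        have split: "(par ^^ (m - p)) v = v0 \<or> (\<exists>j\<le>m. (j, (par ^^ (m - j)) v) \<in> S)" if "v \<in> T m" for v
          using S(2) that pm by (auto simp: tree_covers_def lev_def X_def T_def)
        have below: "(par ^^ (m - k)) v = w" if "(par ^^ (m - p)) v = v0" for v
          using that v0(2) p(2) pm funpow_diff_compose[of k p m par v] by simp
        show ?thesis
        \<comment> \<open>If S contains w or an ancestor of w, it covers the removed part as well.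
          Otherwise everything left below w is covered by members of S strictly below w.\<close>
        proof (cases "\<exists>j\<le>k. (j, (par ^^ (k - j)) w) \<in> S")
          case True
          then obtain j where j: "j \<le> k" "(j, (par ^^ (k - j)) w) \<in> S" by blast
          have "tree_covers par S m (T m)"
            unfolding tree_covers_def
          proof
            fix v assume v: "v \<in> T m"
            show "\<exists>k\<le>m. (k, (par ^^ (m - k)) v) \<in> S"
            proof (cases "(par ^^ (m - p)) v = v0")
              case True
              then have "(par ^^ (m - j)) v = (par ^^ (k - j)) w"
                using below[OF True] funpow_diff_compose[of j k m par v] j(1) p(2) pm by simp
              then show ?thesis using j p(2) pm by (intro exI[of _ j]) auto
            qed (use split[OF v] in blast)
          qed
          then show ?thesis by (rule Tlow[OF S(1)])
        next
          case False
          \<comment> \<open>S1 with v0 covers all that lies below w, so by \<open>big\<close> it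
            weighs more than r k + e; since r p < e, S1 alone outweighs r k. Trading S1 for the
            single node w then yields a cover of the whole of T that is cheaper than S.\<close>
          define S1 where "S1 = {q \<in> S. k < fst q \<and> (par ^^ (fst q - k)) (snd q) = w}"
          have finS1: "finite S1" using S(1) by (simp add: S1_def)
          have "tree_covers par (insert (p, v0) S1) m (D m)"
            unfolding tree_covers_def
          proof
            fix v assume "v \<in> D m"
            then have v: "v \<in> T m" "(par ^^ (m - k)) v = w" by (auto simp: D_def)
            show "\<exists>k\<le>m. (k, (par ^^ (m - k)) v) \<in> insert (p, v0) S1"
            proof (cases "(par ^^ (m - p)) v = v0")
              case True
              then show ?thesis using pm by (intro exI[of _ p]) auto
            next
              case F: False
              then obtain j where j: "j \<le> m" "(j, (par ^^ (m - j)) v) \<in> S" using split[OF v(1)] by blast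
              have "k < j"
              proof (rule ccontr)
                assume "\<not> k < j"
                then have "(par ^^ (m - j)) v = (par ^^ (k - j)) w"
                  using v(2) funpow_diff_compose[of j k m par v] p(2) pm by simp
                then show False using False j \<open>\<not> k < j\<close> by auto
              qed
              then have "(par ^^ (j - k)) ((par ^^ (m - j)) v) = w"
                using v(2) funpow_diff_compose[of k j m par v] j(1) by simp
              then show ?thesis using j \<open>k < j\<close> by (auto simp: S1_def)
            qed
          qed
          then have "r k + e < (\<Sum>q\<in>insert (p, v0) S1. r (fst q))"
            using p(2) pm finS1 by (intro big[of m]) (auto simp: S1_def)
          also have "\<dots> \<le> r p + (\<Sum>q\<in>S1. r (fst q))"
            using finS1 r_pos by (simp add: sum.insert_if less_imp_le)
          finally have S1big: "r k < (\<Sum>q\<in>S1. r (fst q))" using p(1) by simp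
          have "tree_covers par (insert (k, w) (S - S1)) m (T m)"
            unfolding tree_covers_def
          proof
            fix v assume v: "v \<in> T m"
            show "\<exists>j\<le>m. (j, (par ^^ (m - j)) v) \<in> insert (k, w) (S - S1)"
            proof (cases "(par ^^ (m - k)) v = w")
              case True
              then show ?thesis using p(2) pm by (intro exI[of _ k]) auto
            next
              case F: False
              then obtain j where j: "j \<le> m" "(j, (par ^^ (m - j)) v) \<in> S"
                using split[OF v] below by blast
              have "(j, (par ^^ (m - j)) v) \<notin> S1"
                using F j(1) funpow_diff_compose[of k j m par v] by (auto simp: S1_def)
              then show ?thesis using j by blast
            qed
          qed
          then have "c \<le> (\<Sum>q\<in>insert (k, w) (S - S1). r (fst q))"
            by (rule Tlow[rotated]) (use S(1) in simp)
          also have "\<dots> \<le> r k + (\<Sum>q\<in>S - S1. r (fst q))"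
            using S(1) r_pos by (simp add: sum.insert_if less_imp_le)
          also have "(\<Sum>q\<in>S - S1. r (fst q)) = (\<Sum>q\<in>S. r (fst q)) - (\<Sum>q\<in>S1. r (fst q))"
            using S(1) by (intro sum_diff) (auto simp: S1_def)
          finally show ?thesis using S1big by simp
        qed
      qed
    qed
    moreover have "R \<subseteq> X" by (auto simp: X_def)
    ultimately have "X = R" by (rule max)
    moreover have "(p, v0) \<in> X" "(p, v0) \<notin> R" using v0(1) TE by (auto simp: X_def T_def lev_def)
    ultimately show False by simp
  qed
  \<comment> \<open>Refining the nodes on level n pushes a cover one level down. The push from level
    n costs at most (1/2)^(Suc n), and 1 - (1/2)^n is the sum of the costs so far.\<close>
  have deep: "\<exists>m S. finite S \<and> (\<forall>q\<in>S. n \<le> fst q) \<and> tree_covers par S m (T m) \<and>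
        (\<Sum>q\<in>S. r (fst q)) \<le> real (card (E 0)) * r 0 + (1 - (1/2)^n)" for n
  proof (induction n)
    case 0
    have finT: "finite (T 0)" using fin TE finite_subset by blast
    have "(\<Sum>q\<in>Pair 0 ` T 0. r (fst q)) = real (card (T 0)) * r 0"
      by (subst sum.reindex) (auto simp: inj_on_def)
    also have "\<dots> \<le> real (card (E 0)) * r 0"
      using card_mono[OF fin TE, of 0] r_pos[of 0] by (intro mult_right_mono) auto
    finally show ?case using finT
      by (intro exI[of _ 0] exI[of _ "Pair 0 ` T 0"]) (auto simp: tree_covers_def)
  next
    case (Suc n)
    then obtain m S where S: "finite S" "\<forall>q\<in>S. n \<le> fst q" "tree_covers par S m (T m)"
        "(\<Sum>q\<in>S. r (fst q)) \<le> real (card (E 0)) * r 0 + (1 - (1/2)^n)" by blast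
    define B where "B = {w. (n, w) \<in> S}"
    have "Pair n ` B \<subseteq> S" by (auto simp: B_def)
    then have finB: "finite B" using S(1) by (metis finite_imageD finite_subset inj_on_def prod.inject)
    \<comment> \<open>The allowance for one push is shared among the nodes of B; the + 1 covers the
      case of empty B.\<close>
    define e where "e = (1/2)^(Suc n) / (real (card B) + 1)"
    have e: "e > 0" by (auto simp: e_def intro!: divide_pos_pos)
    have "real (card B) * e \<le> (real (card B) + 1) * e" using e by simp
    also have "\<dots> = (1/2)^(Suc n)" unfolding e_def
      by (rule nonzero_mult_div_cancel_left[of "real (card B) + 1", folded times_divide_eq_right]) simp
    finally have card_e: "real (card B) * e \<le> (1/2)^(Suc n)" .
    define P where "P w m S \<longleftrightarrow> n \<le> m \<and> finite S \<and> (\<forall>q\<in>S. n < fst q) \<and>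
      tree_covers par S m {v \<in> T m. (par ^^ (m - n)) v = w} \<and> (\<Sum>q\<in>S. r (fst q)) \<le> r n + e"
      for w m S
    have "\<exists>m S. P w m S" for w using refine[OF e, of n w] unfolding P_def by blast
    then obtain M Q where "\<And>w. P w (M w) (Q w)" by metis
    then have MQ: "\<And>w. n \<le> M w" "\<And>w. finite (Q w)" "\<And>w. \<forall>q\<in>Q w. n < fst q"
      "\<And>w. tree_covers par (Q w) (M w) {v \<in> T (M w). (par ^^ (M w - n)) v = w}"
      "\<And>w. (\<Sum>q\<in>Q w. r (fst q)) \<le> r n + e"
      unfolding P_def by blast+
    define m' where "m' = Max (insert m (M ` B))"
    have m': "m \<le> m'" "\<And>w. w \<in> B \<Longrightarrow> M w \<le> m'" using finB by (auto simp: m'_def intro!: Max_ge)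
    define S' where "S' = {q \<in> S. n < fst q} \<union> (\<Union>w\<in>B. Q w)"
    have "tree_covers par S' m' (T m')"
      unfolding tree_covers_def
    proof
      fix v assume v: "v \<in> T m'"
      then obtain j where j: "j \<le> m" "(j, (par ^^ (m - j)) ((par ^^ (m' - m)) v)) \<in> S"
        using S(3) Tanc[OF v m'(1)] unfolding tree_covers_def by blast
      then have jS: "(j, (par ^^ (m' - j)) v) \<in> S" using funpow_diff_compose[of j m m' par v] m'(1) by simp
      show "\<exists>k\<le>m'. (k, (par ^^ (m' - k)) v) \<in> S'"
      proof (cases "n < j")
        case True
        then show ?thesis using jS j(1) m'(1) by (intro exI[of _ j]) (auto simp: S'_def)
      next
        case False
        then have "j = n" using S(2) jS by force
        define w where "w = (par ^^ (m' - n)) v"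
        have w: "w \<in> B" using jS \<open>j = n\<close> by (simp add: B_def w_def)
        have "(par ^^ (m' - M w)) v \<in> {v \<in> T (M w). (par ^^ (M w - n)) v = w}"
          using Tanc[OF v m'(2)[OF w]] funpow_diff_compose[OF MQ(1) m'(2)[OF w], of par v]
          by (simp add: w_def)
        then obtain i where i: "i \<le> M w" "(i, (par ^^ (M w - i)) ((par ^^ (m' - M w)) v)) \<in> Q w"
          using MQ(4)[of w] unfolding tree_covers_def by blast
        then have "(i, (par ^^ (m' - i)) v) \<in> Q w"
          using funpow_diff_compose[OF i(1) m'(2)[OF w], of par v] by simp
        then show ?thesis using i(1) m'(2)[OF w] w by (intro exI[of _ i]) (auto simp: S'_def)
      qed
    qed
    moreover have "finite S'" using S(1) finB MQ(2) by (auto simp: S'_def)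
    moreover have "\<forall>q\<in>S'. Suc n \<le> fst q" using MQ(3) by (auto simp: S'_def Suc_le_eq)
    moreover have "(\<Sum>q\<in>S'. r (fst q)) \<le> real (card (E 0)) * r 0 + (1 - (1/2)^(Suc n))"
    proof -
      have "(\<Sum>q\<in>S'. r (fst q)) \<le> (\<Sum>q\<in>{q \<in> S. n < fst q}. r (fst q)) + (\<Sum>q\<in>(\<Union>w\<in>B. Q w). r (fst q))"
        unfolding S'_def using S(1) finB MQ(2) r_pos
        by (subst sum_Un) (auto intro!: sum_nonneg simp: less_imp_le)
      also have "(\<Sum>q\<in>(\<Union>w\<in>B. Q w). r (fst q)) \<le> (\<Sum>w\<in>B. \<Sum>q\<in>Q w. r (fst q))"
        using finB MQ(2) r_pos by (intro sum_UN_le) (auto simp: less_imp_le)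
      also have "\<dots> \<le> (\<Sum>w\<in>B. r n + e)" by (intro sum_mono MQ(5))
      also have "\<dots> = real (card B) * r n + real (card B) * e" by (simp add: algebra_simps)
      also have "real (card B) * r n = (\<Sum>q\<in>Pair n ` B. r (fst q))"
        by (subst sum.reindex) (auto simp: inj_on_def)
      also have "(\<Sum>q\<in>{q \<in> S. n < fst q}. r (fst q)) + ((\<Sum>q\<in>Pair n ` B. r (fst q)) + real (card B) * e) =
          (\<Sum>q\<in>{q \<in> S. n < fst q} \<union> Pair n ` B. r (fst q)) + real (card B) * e"
        using S(1) finB by (subst sum.union_disjoint) auto
      also have "{q \<in> S. n < fst q} \<union> Pair n ` B = S"
        using S(2) by (force simp: B_def image_iff)
      finally show ?thesis using S(4) card_e by simp
    qed
    ultimately show ?case by blast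
  qed
  have deep': "\<exists>m S. finite S \<and> (\<forall>q\<in>S. n \<le> fst q) \<and> tree_covers par S m (T m) \<and>
        (\<Sum>q\<in>S. r (fst q)) \<le> real (card (E 0)) * r 0 + 1" for n
  proof -
    have "real (card (E 0)) * r 0 + (1 - (1/2)^n) \<le> real (card (E 0)) * r 0 + 1" by simp
    then show ?thesis using deep[of n] by (meson order_trans)
  qed
  show thesis by (rule that[of T, OF TE Tpar Tlow deep'])
qed

subsection \<open>Subsets of exact dimension\<close>

text \<open>The coordinates F i carry the problem to a compact set in a Euclidean space: d is
  comparable to their sup distance, so compactness and dyadic cubes are available although
  \<open>'p\<close> has no topology. The tree consists of the dyadic cubes met by X, weighted by the
  \<beta>-th power of the side, and K is read off from its thin subtree.\<close>

lemma exact_dimension_subset: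
  fixes F :: "'i::finite \<Rightarrow> real \<Rightarrow> real" and \<phi> :: "real \<Rightarrow> 'p" and d :: "'p \<Rightarrow> 'p \<Rightarrow> real"
  assumes X: "compact X" and cont: "\<And>i. continuous_on X (F i)" and \<beta>: "\<beta> > 0" and C: "C > 0"
    and lowd: "\<And>x y i. x \<in> X \<Longrightarrow> y \<in> X \<Longrightarrow> \<bar>F i x - F i y\<bar> \<le> d (\<phi> x) (\<phi> y)"
    and upd: "\<And>x y m. x \<in> X \<Longrightarrow> y \<in> X \<Longrightarrow> (\<And>i. \<bar>F i x - F i y\<bar> \<le> m) \<Longrightarrow> d (\<phi> x) (\<phi> y) \<le> C * m"
    and pos: "hausdorff_measure d \<beta> (\<phi> ` X) \<noteq> 0"
  obtains K where "K \<subseteq> X" "closed K" "hausdorff_measure d \<beta> (\<phi> ` K) \<noteq> 0"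
    "\<And>s. s > \<beta> \<Longrightarrow> hausdorff_measure d s (\<phi> ` K) = 0"
proof -
  define code where "code n x = (\<lambda>i. \<lfloor>2^n * F i x\<rfloor>)" for n :: nat and x
  define par where "par v = (\<lambda>i. v i div 2)" for v :: "'i \<Rightarrow> int"
  \<comment> \<open>Codes belong to half-open cubes, cells are the closed ones. Closed cells make K
    closed, at the price that a point may lie in several cells of one level.\<close>
  define cell where "cell n v x \<longleftrightarrow> (\<forall>i. of_int (v i) \<le> 2^n * F i x \<and> 2^n * F i x \<le> of_int (v i) + 1)"
    for n :: nat and v :: "'i \<Rightarrow> int" and x
  define E where "E n = code n ` X" for n
  define r where "r k = ((1/2) powr \<beta>) ^ k" for k :: nat
  have r_eq: "r k = ((1/2)^k) powr \<beta>" for k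
    by (simp add: r_def powr_realpow[symmetric] powr_powr mult.commute powr_divide powr_power)
  have half_powr: "(1/2::real) powr t < 1" if "t > 0" for t
    using powr_less_mono2[of t "1/2" 1] that by simp
  have r_pos: "r k > 0" for k by (simp add: r_def)
  have r_lim: "r \<longlonglongrightarrow> 0"
    unfolding r_def using \<beta> by (intro LIMSEQ_power_zero) (simp add: half_powr)
  have finE: "finite (E n)" for n
  proof -
    have "\<forall>i. \<exists>b. \<forall>x\<in>X. \<bar>F i x\<bar> \<le> b"
      using compact_imp_bounded[OF compact_continuous_image[OF cont X]]
      unfolding bounded_iff by auto
    then obtain b where b: "\<And>i x. x \<in> X \<Longrightarrow> \<bar>F i x\<bar> \<le> b i" by metis
    have "E n \<subseteq> Pi\<^sub>E UNIV (\<lambda>i. {\<lfloor>- (2^n * b i)\<rfloor>..\<lfloor>2^n * b i\<rfloor>})"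
    proof
      fix v assume "v \<in> E n"
      then obtain x where x: "x \<in> X" "v = code n x" by (auto simp: E_def)
      have "- (2^n * b i) \<le> 2^n * F i x" "2^n * F i x \<le> 2^n * b i" for i
      proof -
        have "\<bar>F i x\<bar> \<le> b i" using b x(1) by blast
        then have "- b i \<le> F i x" "F i x \<le> b i" by auto
        then show "2^n * F i x \<le> 2^n * b i" by simp
        have "2^n * (- b i) \<le> 2^n * F i x" using \<open>- b i \<le> F i x\<close> by (intro mult_left_mono) auto
        then show "- (2^n * b i) \<le> 2^n * F i x" by simp
      qed
      then show "v \<in> Pi\<^sub>E UNIV (\<lambda>i. {\<lfloor>- (2^n * b i)\<rfloor>..\<lfloor>2^n * b i\<rfloor>})"
        by (auto simp: x(2) code_def intro!: floor_mono)
    qed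
    then show ?thesis by (rule finite_subset) (auto intro!: finite_PiE)
  qed
  have par_code: "par (code (Suc n) x) = code n x" for n x
  proof
    fix i
    have "\<lfloor>(2 ^ Suc n * F i x) / real_of_int 2\<rfloor> = \<lfloor>2 ^ Suc n * F i x\<rfloor> div 2"
      by (rule floor_divide_real_eq_div) simp
    then show "par (code (Suc n) x) i = code n x i" by (simp add: par_def code_def)
  qed
  have anc_code': "(par ^^ j) (code (k + j) x) = code k x" for j k x
    by (induction j) (auto simp: funpow_swap1 par_code)
  have anc_code: "(par ^^ (m - k)) (code m x) = code k x" if "k \<le> m" for k m x
    using anc_code'[of "m - k" k x] that by simp
  have cell_code: "cell n (code n x) x" for n x
    by (auto simp: cell_def code_def real_of_int_floor_add_one_ge)
  have cell_par: "cell n (par v) x" if "cell (Suc n) v x" for n v x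
    unfolding cell_def
  proof
    fix i
    have "2 * (v i div 2) \<le> v i" "v i + 1 \<le> 2 * (v i div 2) + 2" by presburger+
    then have "2 * real_of_int (v i div 2) \<le> of_int (v i)"
      "real_of_int (v i) + 1 \<le> 2 * of_int (v i div 2) + 2" by linarith+
    moreover have "of_int (v i) \<le> 2 * (2^n * F i x)" "2 * (2^n * F i x) \<le> of_int (v i) + 1"
      using that by (auto simp: cell_def mult.assoc)
    ultimately show "of_int (par v i) \<le> 2^n * F i x \<and> 2^n * F i x \<le> of_int (par v i) + 1"
      unfolding par_def by linarith
  qed
  have cell_anc': "cell k ((par ^^ j) v) x" if "cell (k + j) v x" for k j v x
    using that
  proof (induction j arbitrary: v)
    case (Suc j)
    then have "cell (k + j) (par v) x" using cell_par by simp
    then show ?case using Suc.IH by (simp add: funpow_swap1)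
  qed simp
  have cell_anc: "cell k ((par ^^ (m - k)) v) x" if "cell m v x" "k \<le> m" for k m v x
    using cell_anc'[of k "m - k" v x] that by simp
  have cell_diam: "d (\<phi> x) (\<phi> y) \<le> C * (1/2)^k"
    if "x \<in> X" "y \<in> X" "cell k v x" "cell k v y" for x y k v
  proof (rule upd[OF that(1,2)])
    fix i
    have "of_int (v i) \<le> 2^k * F i x" "2^k * F i x \<le> of_int (v i) + 1"
      "of_int (v i) \<le> 2^k * F i y" "2^k * F i y \<le> of_int (v i) + 1"
      using that(3,4) by (auto simp: cell_def)
    then have "\<bar>2^k * F i x - 2^k * F i y\<bar> \<le> 1" by linarith
    also have "2^k * F i x - 2^k * F i y = 2^k * (F i x - F i y)" by (simp add: algebra_simps)
    finally have "2^k * \<bar>F i x - F i y\<bar> \<le> 1" by (simp add: abs_mult)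
    then show "\<bar>F i x - F i y\<bar> \<le> (1/2)^k" by (simp add: power_one_over field_simps)
  qed
  have w_eq: "(C * (1/2)^k) powr \<beta> = C powr \<beta> * r k" for k
    using C by (simp add: powr_mult r_eq)
  \<comment> \<open>Contrapositive of the finite covering criterion: finite covers of the image
    weigh more than some e. A node cover is such a cover by pieces of size C * (1/2)^k, hence the
    division by C powr \<beta>.\<close>
  obtain c where c: "c > 0" and
    low: "\<And>m S. finite S \<Longrightarrow> tree_covers par S m (E m) \<Longrightarrow> c \<le> (\<Sum>q\<in>S. r (fst q))"
  proof -
    obtain e where e: "e > 0" and
      ne: "\<not> (\<exists>(J::(nat \<times> ('i \<Rightarrow> int)) set) U w. finite J \<and> \<phi> ` X \<subseteq> (\<Union>j\<in>J. U j) \<and> (\<forall>j\<in>J. w j \<ge> 0) \<and>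
        (\<forall>j\<in>J. \<forall>x\<in>U j. \<forall>y\<in>U j. d x y \<le> w j) \<and> (\<Sum>j\<in>J. w j powr \<beta>) \<le> e)"
      using hausdorff_measure_eq_0I_finite[OF \<beta>, of "\<phi> ` X" d] pos by blast
    show thesis
    proof (rule that[of "e / C powr \<beta>"])
      show "e / C powr \<beta> > 0" using e C by simp
      fix m and S :: "(nat \<times> ('i \<Rightarrow> int)) set"
      assume S: "finite S" "tree_covers par S m (E m)"
      define U where "U q = \<phi> ` {x \<in> X. code (fst q) x = snd q}" for q :: "nat \<times> ('i \<Rightarrow> int)"
      define w where "w q = C * (1/2)^(fst q)" for q :: "nat \<times> ('i \<Rightarrow> int)"
      have "\<phi> ` X \<subseteq> (\<Union>q\<in>S. U q)"
      proof
        fix z assume "z \<in> \<phi> ` X"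
        then obtain x where x: "x \<in> X" "z = \<phi> x" by blast
        then obtain k where k: "k \<le> m" "(k, (par ^^ (m - k)) (code m x)) \<in> S"
          using S(2) unfolding tree_covers_def E_def by blast
        then have "(k, code k x) \<in> S" by (simp add: anc_code)
        moreover have "z \<in> U (k, code k x)" using x by (auto simp: U_def)
        ultimately show "z \<in> (\<Union>q\<in>S. U q)" by blast
      qed
      moreover have "\<forall>q\<in>S. w q \<ge> 0" using C by (simp add: w_def)
      moreover have "\<forall>q\<in>S. \<forall>x\<in>U q. \<forall>y\<in>U q. d x y \<le> w q"
        unfolding U_def w_def using cell_code by (auto intro!: cell_diam) metis
      ultimately have "e < (\<Sum>q\<in>S. w q powr \<beta>)" using ne S(1) by (meson not_le)
      also have "\<dots> = C powr \<beta> * (\<Sum>q\<in>S. r (fst q))" by (simp add: w_def w_eq sum_distrib_left)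
      finally show "e / C powr \<beta> \<le> (\<Sum>q\<in>S. r (fst q))" using C by (simp add: field_simps)
    qed
  qed
  have parE: "par v \<in> E n" if "v \<in> E (Suc n)" for n v using that by (auto simp: E_def par_code)
  obtain T where T: "\<And>n. T n \<subseteq> E n" "\<And>n v. v \<in> T (Suc n) \<Longrightarrow> par v \<in> T n"
    "\<And>m S. finite S \<Longrightarrow> tree_covers par S m (T m) \<Longrightarrow> c \<le> (\<Sum>q\<in>S. r (fst q))"
    "\<And>n. \<exists>m S. finite S \<and> (\<forall>q\<in>S. n \<le> fst q) \<and> tree_covers par S m (T m) \<and>
        (\<Sum>q\<in>S. r (fst q)) \<le> real (card (E 0)) * r 0 + 1"
  proof (rule thin_subtree_exists[of E par r c])
    show "finite (E n)" for n by (rule finE)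
    show "par v \<in> E n" if "v \<in> E (Suc n)" for n v using that by (rule parE)
    show "r k > 0" for k by (rule r_pos)
    show "c \<le> (\<Sum>q\<in>S. r (fst q))" if "finite S" "tree_covers par S m (E m)" for m S
      using that by (rule low)
  qed (rule r_lim, rule that)
  define Km where "Km m = (\<Union>v\<in>T m. {x \<in> X. cell m v x})" for m
  define K where "K = (\<Inter>m. Km m)"
  have finT: "finite (T m)" for m using finE T(1) finite_subset by blast
  have closedX: "closed X" using X by (rule compact_imp_closed)
  have Km_closed: "closed (Km m)" for m
  proof -
    have "{x \<in> X. cell m v x} = (\<Inter>i. {x \<in> X. of_int (v i) \<le> 2^m * F i x} \<inter>
        {x \<in> X. 2^m * F i x \<le> of_int (v i) + 1})" for v
      by (auto simp: cell_def)
    moreover have "closed (\<Inter>i. {x \<in> X. of_int (v i) \<le> 2^m * F i x} \<inter>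
        {x \<in> X. 2^m * F i x \<le> of_int (v i) + 1})" for v
      by (intro closed_INT ballI closed_Int continuous_on_closed_Collect_le continuous_intros cont closedX)
    ultimately have "closed {x \<in> X. cell m v x}" for v by simp
    then show ?thesis unfolding Km_def using finT by (intro closed_UN) auto
  qed
  have KmX: "Km m \<subseteq> X" for m by (auto simp: Km_def)
  have Km_dec: "Km n \<subseteq> Km m" if "m \<le> n" for m n
  proof -
    have "Km (Suc m) \<subseteq> Km m" for m unfolding Km_def using T(2) cell_par by blast
    then show ?thesis using lift_Suc_antimono_le[of Km m n] that by blast
  qed
  have KX: "K \<subseteq> X" using KmX[of 0] by (auto simp: K_def)
  have K_closed: "closed K" unfolding K_def using Km_closed by blast
  show thesis
  proof
    show "K \<subseteq> X" by (rule KX)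
    show "closed K" by (rule K_closed)
  next
    fix s assume s: "s > \<beta>"
    define W where "W = real (card (E 0)) * r 0 + 1"
    have W: "W > 0" using r_pos[of 0] by (simp add: W_def add_nonneg_pos)
    show "hausdorff_measure d s (\<phi> ` K) = 0"
    proof (rule hausdorff_measure_eq_0I_finite)
      fix e :: real assume e: "e > 0"
      \<comment> \<open>On levels k \<ge> n the s-th power of the side is at most ((1/2) powr (s -
        \<beta>))^n times r k, so the bounded weight W is multiplied by a factor tending to
        0.\<close>
      have "(\<lambda>n. C powr s * (((1/2) powr (s - \<beta>))^n * W)) \<longlonglongrightarrow> C powr s * (0 * W)"
        using s by (intro tendsto_intros LIMSEQ_power_zero) (simp add: half_powr)
      then have "\<forall>\<^sub>F n in sequentially. C powr s * (((1/2) powr (s - \<beta>))^n * W) < e"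
        using e by (intro order_tendstoD(2)) auto
      then obtain n where n: "C powr s * (((1/2) powr (s - \<beta>))^n * W) < e"
        unfolding eventually_sequentially by blast
      obtain m S where S: "finite S" "\<forall>q\<in>S. n \<le> fst q" "tree_covers par S m (T m)"
        "(\<Sum>q\<in>S. r (fst q)) \<le> W" using T(4)[of n] unfolding W_def by blast
      define U where "U q = \<phi> ` {x \<in> X. cell (fst q) (snd q) x}" for q :: "nat \<times> ('i \<Rightarrow> int)"
      define w where "w q = C * (1/2)^(fst q)" for q :: "nat \<times> ('i \<Rightarrow> int)"
      have "\<phi> ` K \<subseteq> (\<Union>q\<in>S. U q)"
      proof
        fix z assume "z \<in> \<phi> ` K"
        then obtain x v where x: "x \<in> X" "z = \<phi> x" "v \<in> T m" "cell m v x"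
          unfolding K_def Km_def by blast
        then obtain k where k: "k \<le> m" "(k, (par ^^ (m - k)) v) \<in> S"
          using S(3) unfolding tree_covers_def by blast
        moreover have "z \<in> U (k, (par ^^ (m - k)) v)" using x cell_anc k(1) by (auto simp: U_def)
        ultimately show "z \<in> (\<Union>q\<in>S. U q)" by blast
      qed
      moreover have "\<forall>q\<in>S. w q \<ge> 0" using C by (simp add: w_def)
      moreover have "\<forall>q\<in>S. \<forall>x\<in>U q. \<forall>y\<in>U q. d x y \<le> w q"
        unfolding U_def w_def by (auto intro: cell_diam)
      moreover have "(\<Sum>q\<in>S. w q powr s) \<le> e"
      proof -
        have "w q powr s \<le> C powr s * (((1/2) powr (s - \<beta>))^n * r (fst q))" if "q \<in> S" for q
        proof -
          have "w q powr s = C powr s * ((1/2)^(fst q)) powr s"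
            using C by (simp add: w_def powr_mult)
          also have "((1/2::real)^(fst q)) powr s = ((1/2)^(fst q)) powr (s - \<beta>) * r (fst q)"
            by (simp add: r_eq powr_add[symmetric])
          also have "((1/2::real)^(fst q)) powr (s - \<beta>) \<le> ((1/2)^n) powr (s - \<beta>)"
            using s S(2) that by (intro powr_mono2 power_decreasing) auto
          also have "((1/2::real)^n) powr (s - \<beta>) = ((1/2) powr (s - \<beta>))^n"
            by (simp add: powr_realpow[symmetric] powr_powr mult.commute powr_divide powr_power)
          finally show ?thesis using r_pos[of "fst q"] by (simp add: mult_left_mono mult_right_mono)
        qed
        then have "(\<Sum>q\<in>S. w q powr s) \<le> (\<Sum>q\<in>S. C powr s * (((1/2) powr (s - \<beta>))^n * r (fst q)))"
          by (rule sum_mono)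
        also have "\<dots> = C powr s * (((1/2) powr (s - \<beta>))^n * (\<Sum>q\<in>S. r (fst q)))"
          by (simp add: sum_distrib_left)
        also have "\<dots> \<le> C powr s * (((1/2) powr (s - \<beta>))^n * W)"
          using S(4) by (intro mult_left_mono) auto
        finally show ?thesis using n by simp
      qed
      ultimately show "\<exists>(J::(nat \<times> ('i \<Rightarrow> int)) set) U w. finite J \<and> \<phi> ` K \<subseteq> (\<Union>j\<in>J. U j) \<and> (\<forall>j\<in>J. w j \<ge> 0) \<and>
        (\<forall>j\<in>J. \<forall>x\<in>U j. \<forall>y\<in>U j. d x y \<le> w j) \<and> (\<Sum>j\<in>J. w j powr s) \<le> e"
        using S(1) by blast
    qed (use s \<beta> in simp)
  next
    show "hausdorff_measure d \<beta> (\<phi> ` K) \<noteq> 0"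
    proof
      assume null: "hausdorff_measure d \<beta> (\<phi> ` K) = 0"
      \<comment> \<open>Five codes per coordinate: that of the centre and two on either side. They
        include the codes of all points whose distance from the centre is at most the side of the
        cubes.\<close>
      define N where "N = (5::real) ^ CARD('i)"
      have N: "N > 0" by (simp add: N_def)
      \<comment> \<open>The 1 keeps every w j \<le> 1; the other bound brings the weight of the
        final node cover down to c / 2.\<close>
      define e where "e = min 1 (c / (2 * N * 2 powr \<beta>))"
      have e: "e > 0" using c N by (simp add: e_def)
      obtain U w where U: "\<phi> ` K \<subseteq> (\<Union>i::nat. U i)" "\<And>i. w i > 0"
        "\<And>i x y. x \<in> U i \<Longrightarrow> y \<in> U i \<Longrightarrow> d x y < w i" "(\<Sum>i. ennreal (w i powr \<beta>)) \<le> ennreal e"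
        by (rule hausdorff_measure_eq_0D[OF \<beta> null e]) (rule that)
      have w1: "w j \<le> 1" for j
      proof -
        have "ennreal (w j powr \<beta>) \<le> ennreal e"
          using ennreal_le_suminf[of "\<lambda>j. ennreal (w j powr \<beta>)" j] U(4) by (rule order_trans)
        then have "w j powr \<beta> \<le> 1" using e by (simp add: e_def)
        then show ?thesis using \<beta> U(2)[of j] gr_one_powr[of "w j" \<beta>] by linarith
      qed
      \<comment> \<open>The dyadic level of w j: (1/2)^(Suc (\<kappa> j)) < w j \<le>
        (1/2)^(\<kappa> j), where for \<kappa> j = 0 the upper bound is w j \<le> 1.\<close>
      define \<kappa> where "\<kappa> j = (LEAST k. (1/2)^(Suc k) < w j)" for j
      have \<kappa>1: "(1/2)^(Suc (\<kappa> j)) < w j" for j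
      proof -
        obtain k where "(1/2)^k < w j" using real_arch_pow_inv[OF U(2)[of j], of "1/2"] by auto
        then have "(1/2)^(Suc k) < w j" by (rule le_less_trans[rotated]) simp
        then show ?thesis unfolding \<kappa>_def by (rule LeastI)
      qed
      have \<kappa>2: "w j \<le> (1/2)^(\<kappa> j)" for j
      proof (cases "\<kappa> j")
        case 0
        then show ?thesis using w1 by simp
      next
        case (Suc k)
        then have "\<not> (1/2)^(Suc k) < w j" unfolding \<kappa>_def by (metis lessI not_less_Least)
        then show ?thesis using Suc by simp
      qed
      have r_le: "r (\<kappa> j) \<le> 2 powr \<beta> * w j powr \<beta>" for j
      proof -
        have "(1/2)^(\<kappa> j) \<le> 2 * w j" using \<kappa>1[of j] by simp
        then have "r (\<kappa> j) \<le> (2 * w j) powr \<beta>" unfolding r_eq using \<beta> by (intro powr_mono2) auto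
        also have "\<dots> = 2 powr \<beta> * w j powr \<beta>" using U(2)[of j] by (simp add: powr_mult)
        finally show ?thesis .
      qed
      define ctr where "ctr j = (SOME x. x \<in> K \<and> \<phi> x \<in> U j)" for j
      define V where "V j = {x \<in> X. \<forall>i. \<bar>F i x - F i (ctr j)\<bar> < w j}" for j
      have KV: "K \<subseteq> (\<Union>j. V j)"
      proof
        fix x assume x: "x \<in> K"
        then obtain j where j: "\<phi> x \<in> U j" using U(1) by blast
        have ctr: "ctr j \<in> K \<and> \<phi> (ctr j) \<in> U j"
          unfolding ctr_def by (rule someI[of _ x]) (use x j in simp)
        have inX: "x \<in> X" "ctr j \<in> X" using x ctr KX by blast+
        have "\<bar>F i x - F i (ctr j)\<bar> < w j" for i
          using lowd[OF inX, of i] U(3)[OF j, of "\<phi> (ctr j)"] ctr by linarith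
        then show "x \<in> (\<Union>j. V j)" using inX by (auto simp: V_def)
      qed
      have "openin (top_of_set X) (V j)" for j
      proof -
        have "V j = (\<Inter>i. X \<inter> (\<lambda>x. \<bar>F i x - F i (ctr j)\<bar>) -` {..<w j})"
          by (auto simp: V_def)
        moreover have "openin (top_of_set X) (X \<inter> (\<lambda>x. \<bar>F i x - F i (ctr j)\<bar>) -` {..<w j})" for i
          by (intro continuous_openin_preimage_gen continuous_intros cont open_lessThan)
        ultimately show ?thesis
          by (simp only:) (rule openin_INT2[of UNIV], auto)
      qed
      then have "\<forall>j. \<exists>O'. open O' \<and> V j = X \<inter> O'" by (simp add: openin_open)
      then obtain O' where O': "\<And>j. open (O' j)" "\<And>j. V j = X \<inter> O' j" by metis
      have "compact K" using compact_Int_closed[OF X K_closed] KX by (simp add: Int_absorb1)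
      moreover have "K \<subseteq> (\<Union>j\<in>UNIV. O' j)" using KV O'(2) by blast
      ultimately obtain J where "J \<subseteq> UNIV" and J: "finite J" "K \<subseteq> (\<Union>j\<in>J. O' j)"
        by (rule compactE_image[OF _ O'(1)])
      \<comment> \<open>The content bound concerns nodes of T, and a point coded by such a node need
        not lie in K. The finite cover of K therefore has to be extended to some Km m, by the
        intersection property of nested compact sets.\<close>
      have "\<exists>m. Km m \<subseteq> (\<Union>j\<in>J. O' j)"
      proof (rule ccontr)
        assume "\<not> ?thesis"
        then have "Km m - (\<Union>j\<in>J. O' j) \<noteq> {}" for m by blast
        moreover have "compact (Km m - (\<Union>j\<in>J. O' j))" for m
          using compact_Int_closed[OF X Km_closed[of m]] KmX[of m] O'(1)
          by (intro compact_diff open_UN) (auto simp: Int_absorb1)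
        ultimately have "(\<Inter>m. Km m - (\<Union>j\<in>J. O' j)) \<noteq> {}"
          using Km_dec by (intro compact_nest conjI Diff_mono) auto
        then show False using J(2) by (auto simp: K_def)
      qed
      then obtain m0 where m0: "Km m0 \<subseteq> (\<Union>j\<in>J. O' j)" by blast
      define m where "m = Max (insert m0 (\<kappa> ` J))"
      have m: "m0 \<le> m" "\<And>j. j \<in> J \<Longrightarrow> \<kappa> j \<le> m" using J(1) by (auto simp: m_def intro!: Max_ge)
      define B where "B j = Pi\<^sub>E UNIV (\<lambda>i. {\<lfloor>2^(\<kappa> j) * F i (ctr j)\<rfloor> - 2 .. \<lfloor>2^(\<kappa> j) * F i (ctr j)\<rfloor> + 2})" for j
      have finB: "finite (B j)" for j unfolding B_def by (auto intro!: finite_PiE)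
      have cardB: "real (card (B j)) = N" for j
        unfolding B_def N_def by (simp add: card_PiE)
      define S where "S = (\<Union>j\<in>J. Pair (\<kappa> j) ` B j)"
      have "tree_covers par S m (T m)"
        unfolding tree_covers_def
      proof
        fix v assume v: "v \<in> T m"
        then obtain x where x: "x \<in> X" "v = code m x" using T(1) by (auto simp: E_def)
        have "x \<in> Km m" using x v cell_code by (auto simp: Km_def)
        then obtain j where j: "j \<in> J" "x \<in> V j" using m0 Km_dec[OF m(1)] O'(2) x(1) by blast
        have "code (\<kappa> j) x \<in> B j"
          unfolding B_def
        proof (rule PiE_I)
          fix i
          have "\<bar>F i x - F i (ctr j)\<bar> \<le> (1/2)^(\<kappa> j)" using j(2) \<kappa>2[of j] by (auto simp: V_def intro: less_imp_le order_trans)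
          then have "2^(\<kappa> j) * \<bar>F i x - F i (ctr j)\<bar> \<le> 1" by (simp add: power_one_over field_simps)
          then have "\<bar>2^(\<kappa> j) * F i x - 2^(\<kappa> j) * F i (ctr j)\<bar> \<le> 1"
            by (simp add: abs_mult flip: right_diff_distrib)
          then show "code (\<kappa> j) x i \<in> {\<lfloor>2^(\<kappa> j) * F i (ctr j)\<rfloor> - 2 .. \<lfloor>2^(\<kappa> j) * F i (ctr j)\<rfloor> + 2}"
            unfolding code_def atLeastAtMost_iff by linarith
        qed simp
        then have "(\<kappa> j, (par ^^ (m - \<kappa> j)) v) \<in> S" using j(1) m(2) x(2) by (auto simp: S_def anc_code)
        then show "\<exists>k\<le>m. (k, (par ^^ (m - k)) v) \<in> S" using m(2) j(1) by blast
      qed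
      moreover have finS: "finite S" using J(1) finB by (auto simp: S_def)
      ultimately have "c \<le> (\<Sum>q\<in>S. r (fst q))" by (intro T(3))
      also have "\<dots> \<le> (\<Sum>j\<in>J. \<Sum>q\<in>Pair (\<kappa> j) ` B j. r (fst q))"
        unfolding S_def using J(1) finB r_pos by (intro sum_UN_le) (auto simp: less_imp_le)
      also have "\<dots> = (\<Sum>j\<in>J. N * r (\<kappa> j))"
        by (intro sum.cong refl, subst sum.reindex) (auto simp: inj_on_def cardB)
      also have "\<dots> \<le> (\<Sum>j\<in>J. N * (2 powr \<beta> * w j powr \<beta>))"
        using N by (intro sum_mono mult_left_mono r_le) auto
      also have "\<dots> = N * 2 powr \<beta> * (\<Sum>j\<in>J. w j powr \<beta>)" by (simp add: sum_distrib_left mult_ac)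
      also have "(\<Sum>j\<in>J. w j powr \<beta>) \<le> e"
      proof -
        have "ennreal (\<Sum>j\<in>J. w j powr \<beta>) = (\<Sum>j\<in>J. ennreal (w j powr \<beta>))" by (simp add: sum_ennreal)
        also have "\<dots> \<le> (\<Sum>j. ennreal (w j powr \<beta>))" by (rule sum_le_suminf) (use J(1) in auto)
        also have "\<dots> \<le> ennreal e" by (rule U(4))
        finally show ?thesis using e by (simp add: ennreal_le_iff)
      qed
      also have "N * 2 powr \<beta> * e \<le> N * 2 powr \<beta> * (c / (2 * N * 2 powr \<beta>))"
        using N by (intro mult_left_mono) (auto simp: e_def)
      also have "\<dots> = c / 2" using N by simp
      finally show False using c N by simp
    qed
  qed
qed

subsection \<open>Splittings that are thin off a closed set\<close>

text \<open>Inf-convolution with L * \<bar>x - y\<bar>: an infimum of L-Lipschitz functions is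
  L-Lipschitz, the choice y = x puts it below \<phi>, and it inherits every lower bound of
  \<phi>.\<close>

lemma Lipschitz_approx_below:
  fixes \<phi> :: "real \<Rightarrow> real"
  assumes ab: "a \<le> b" and cont: "continuous_on {a..b} \<phi>" and \<epsilon>: "\<epsilon> > 0"
  obtains p L where "L \<ge> 0" "\<And>x y. \<bar>p x - p y\<bar> \<le> L * \<bar>x - y\<bar>"
    "\<And>x. x \<in> {a..b} \<Longrightarrow> p x \<le> \<phi> x" "\<And>x. x \<in> {a..b} \<Longrightarrow> \<phi> x - \<epsilon> \<le> p x"
    "\<And>c x. (\<forall>x\<in>{a..b}. c \<le> \<phi> x) \<Longrightarrow> c \<le> p x"
proof -
  have "bounded (\<phi> ` {a..b})" using cont by (intro compact_imp_bounded compact_continuous_image) auto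
  then obtain B where B: "B > 0" "\<And>x. x \<in> {a..b} \<Longrightarrow> \<bar>\<phi> x\<bar> \<le> B"
    unfolding bounded_pos by auto
  have "uniformly_continuous_on {a..b} \<phi>" using cont by (intro compact_uniformly_continuous) auto
  then obtain \<eta> where \<eta>: "\<eta> > 0" "\<And>x y. x \<in> {a..b} \<Longrightarrow> y \<in> {a..b} \<Longrightarrow> \<bar>y - x\<bar> < \<eta> \<Longrightarrow> \<bar>\<phi> y - \<phi> x\<bar> < \<epsilon>"
    using \<epsilon> unfolding uniformly_continuous_on_def dist_real_def by meson
  \<comment> \<open>Moving y away by \<eta> or more costs at least 2 * B, which is all that \<phi>
    can drop; at closer points \<phi> drops by less than \<epsilon>.\<close>
  define L where "L = 2 * B / \<eta>"
  have L: "L > 0" using B \<eta> by (simp add: L_def)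
  define p where "p x = (INF y\<in>{a..b}. \<phi> y + L * \<bar>x - y\<bar>)" for x
  have ne: "{a..b} \<noteq> {}" using ab by simp
  have bdd: "bdd_below ((\<lambda>y. \<phi> y + L * \<bar>x - y\<bar>) ` {a..b})" for x
  proof (rule bdd_belowI2)
    fix y assume "y \<in> {a..b}"
    then have "- B \<le> \<phi> y" using B(2)[of y] by linarith
    moreover have "0 \<le> L * \<bar>x - y\<bar>" using L by simp
    ultimately show "- B \<le> \<phi> y + L * \<bar>x - y\<bar>" by linarith
  qed
  have p_le: "p x \<le> \<phi> y + L * \<bar>x - y\<bar>" if "y \<in> {a..b}" for x y
    unfolding p_def by (rule cINF_lower[OF bdd that])
  have p_ge: "c \<le> p x" if "\<And>y. y \<in> {a..b} \<Longrightarrow> c \<le> \<phi> y + L * \<bar>x - y\<bar>" for c x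
    unfolding p_def by (rule cINF_greatest[OF ne that])
  have half: "p x - L * \<bar>x - y\<bar> \<le> p y" for x y
  proof (rule p_ge)
    fix z assume z: "z \<in> {a..b}"
    have "L * \<bar>x - z\<bar> \<le> L * (\<bar>x - y\<bar> + \<bar>y - z\<bar>)" using L by (intro mult_left_mono) auto
    then show "p x - L * \<bar>x - y\<bar> \<le> \<phi> z + L * \<bar>y - z\<bar>"
      using p_le[OF z, of x] by (simp add: algebra_simps)
  qed
  show thesis
  proof (rule that[of L p])
    show "L \<ge> 0" using L by simp
    show "\<bar>p x - p y\<bar> \<le> L * \<bar>x - y\<bar>" for x y
      using half[of x y] half[of y x] by (simp add: abs_minus_commute abs_le_iff)
    show "p x \<le> \<phi> x" if "x \<in> {a..b}" for x using p_le[OF that, of x] by simp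
    show "\<phi> x - \<epsilon> \<le> p x" if x: "x \<in> {a..b}" for x
    proof (rule p_ge)
      fix y assume y: "y \<in> {a..b}"
      show "\<phi> x - \<epsilon> \<le> \<phi> y + L * \<bar>x - y\<bar>"
      proof (cases "\<bar>y - x\<bar> < \<eta>")
        case True
        moreover have "0 \<le> L * \<bar>x - y\<bar>" using L by simp
        ultimately show ?thesis using \<eta>(2)[OF x y] by linarith
      next
        case False
        then have "L * \<eta> \<le> L * \<bar>x - y\<bar>" using L by (intro mult_left_mono) auto
        moreover have "L * \<eta> = 2 * B" using \<eta>(1) by (simp add: L_def)
        ultimately show ?thesis using B(2)[OF x] B(2)[OF y] \<epsilon> by linarith
      qed
    qed
    show "c \<le> p x" if "\<forall>x\<in>{a..b}. c \<le> \<phi> x" for c x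
    proof (rule p_ge)
      fix y assume "y \<in> {a..b}"
      moreover have "0 \<le> L * \<bar>x - y\<bar>" using L by simp
      ultimately show "c \<le> \<phi> y + L * \<bar>x - y\<bar>" using that by fastforce
    qed
  qed
qed

text \<open>Truncating the modification by the distance to \<open>K\<close> leaves \<open>\<phi>\<close> unchanged on \<open>K\<close>.\<close>

lemma Lipschitz_approx_off:
  fixes \<phi> :: "real \<Rightarrow> real"
  assumes ab: "a \<le> b" and cont: "continuous_on {a..b} \<phi>" and \<epsilon>: "\<epsilon> > 0"
  obtains \<psi> L where "L \<ge> 0" "continuous_on {a..b} \<psi>"
    "\<And>x. x \<in> {a..b} \<Longrightarrow> \<psi> x \<le> \<phi> x" "\<And>x. x \<in> {a..b} \<Longrightarrow> \<phi> x - \<epsilon> \<le> \<psi> x"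
    "\<And>x. x \<in> {a..b} \<Longrightarrow> x \<in> K \<Longrightarrow> \<psi> x = \<phi> x"
    "\<And>x y. x \<in> {a..b} \<Longrightarrow> y \<in> {a..b} \<Longrightarrow> infdist x K \<ge> \<epsilon> \<Longrightarrow> infdist y K \<ge> \<epsilon> \<Longrightarrow> \<bar>\<psi> x - \<psi> y\<bar> \<le> L * \<bar>x - y\<bar>"
    "\<And>x. (\<forall>x\<in>{a..b}. 0 \<le> \<phi> x) \<Longrightarrow> 0 \<le> \<psi> x"
proof -
  obtain p L where p: "L \<ge> 0" "\<And>x y. \<bar>p x - p y\<bar> \<le> L * \<bar>x - y\<bar>"
    "\<And>x. x \<in> {a..b} \<Longrightarrow> p x \<le> \<phi> x" "\<And>x. x \<in> {a..b} \<Longrightarrow> \<phi> x - \<epsilon> \<le> p x"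
    "\<And>c x. (\<forall>x\<in>{a..b}. c \<le> \<phi> x) \<Longrightarrow> c \<le> p x"
    using Lipschitz_approx_below[OF assms] by metis
  have "L-lipschitz_on {a..b} p" using p(1,2) by (auto simp: lipschitz_on_def dist_real_def)
  then have cp: "continuous_on {a..b} p" by (rule lipschitz_on_continuous_on)
  \<comment> \<open>At distance at least \<epsilon> from K the second term is at most \<phi> x -
    \<epsilon>, hence at most p x, so \<psi> is the Lipschitz function there.\<close>
  define \<psi> where "\<psi> x = max (p x) (\<phi> x - infdist x K)" for x
  have \<psi>p: "\<psi> x = p x" if "x \<in> {a..b}" "infdist x K \<ge> \<epsilon>" for x
    using p(4)[OF that(1)] that(2) by (simp add: \<psi>_def)
  show thesis
  proof (rule that[of L \<psi>])
    show "continuous_on {a..b} \<psi>" unfolding \<psi>_def by (intro continuous_intros cp cont)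
    show "\<psi> x \<le> \<phi> x" if "x \<in> {a..b}" for x using p(3)[OF that] infdist_nonneg[of x K] by (simp add: \<psi>_def)
    show "\<phi> x - \<epsilon> \<le> \<psi> x" if "x \<in> {a..b}" for x using p(4)[OF that] by (simp add: \<psi>_def)
    show "\<psi> x = \<phi> x" if "x \<in> {a..b}" "x \<in> K" for x using p(3)[OF that(1)] that(2) by (simp add: \<psi>_def)
    show "\<bar>\<psi> x - \<psi> y\<bar> \<le> L * \<bar>x - y\<bar>"
      if "x \<in> {a..b}" "y \<in> {a..b}" "infdist x K \<ge> \<epsilon>" "infdist y K \<ge> \<epsilon>" for x y
      using \<psi>p that p(2) by simp
    show "0 \<le> \<psi> x" if "\<forall>x\<in>{a..b}. 0 \<le> \<phi> x" for x using p(5)[OF that, of x] by (simp add: \<psi>_def)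
  qed (rule p(1))
qed

lemma uniform_Cauchy_limit:
  fixes G :: "nat \<Rightarrow> real \<Rightarrow> real"
  assumes cont: "\<And>n. continuous_on I (G n)" and \<delta>: "\<delta> \<longlonglongrightarrow> 0"
    and close: "\<And>n j x. x \<in> I \<Longrightarrow> \<bar>G (n + j) x - G n x\<bar> \<le> \<delta> n"
  obtains g where "continuous_on I g" "\<And>x. x \<in> I \<Longrightarrow> (\<lambda>n. G n x) \<longlonglongrightarrow> g x"
    "\<And>n x. x \<in> I \<Longrightarrow> \<bar>g x - G n x\<bar> \<le> \<delta> n"
proof -
  have "uniformly_Cauchy_on I G"
  proof (rule uniformly_Cauchy_onI')
    fix e :: real assume "e > 0"
    then obtain M where M: "\<And>n. n \<ge> M \<Longrightarrow> \<delta> n < e"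
      using order_tendstoD(2)[OF \<delta>] unfolding eventually_sequentially by blast
    have "dist (G m x) (G n x) < e" if "x \<in> I" "m \<ge> M" "n > m" for x m n
      using close[OF that(1), of m "n - m"] M[OF that(2)] that(3)
      by (simp add: dist_real_def abs_minus_commute)
    then show "\<exists>M. \<forall>x\<in>I. \<forall>m\<ge>M. \<forall>n>m. dist (G m x) (G n x) < e" by blast
  qed
  then have "uniformly_convergent_on I G" by (rule Cauchy_uniformly_convergent)
  then obtain g where g: "uniform_limit I G g sequentially" by (auto simp: uniformly_convergent_on_def)
  have lim: "(\<lambda>n. G n x) \<longlonglongrightarrow> g x" if "x \<in> I" for x using g that by (rule tendsto_uniform_limitI)
  show thesis
  proof (rule that[of g])
    show "continuous_on I g" by (rule uniform_limit_theorem[OF _ g]) (auto simp: cont)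
    show "\<bar>g x - G n x\<bar> \<le> \<delta> n" if x: "x \<in> I" for n x
    proof (rule LIMSEQ_le_const2)
      show "(\<lambda>j. \<bar>G (j + n) x - G n x\<bar>) \<longlonglongrightarrow> \<bar>g x - G n x\<bar>"
        by (intro tendsto_intros LIMSEQ_ignore_initial_segment lim x)
      show "\<exists>N. \<forall>j\<ge>N. \<bar>G (j + n) x - G n x\<bar> \<le> \<delta> n"
        using close[OF x, of n] by (auto simp: add.commute)
    qed
  qed (rule lim)
qed

section \<open>Thin splittings by a category argument\<close>

locale splitting =
  fixes a b \<beta> :: real and K :: "real set" and l w :: "real \<Rightarrow> real"
  assumes ab: "a < b" and \<beta>: "\<beta> > 1"
    and cont_l: "continuous_on {a..b} l" and cont_w: "continuous_on {a..b} w"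
    and w_nonneg: "\<And>x. x \<in> {a..b} \<Longrightarrow> w x \<ge> 0"
begin

text \<open>A discrete form of small \<beta>-content off K: over N equal intervals the graph breaks
  into pieces of size about d. Comparing pairs of points instead of naming a cover makes stability
  under uniform perturbation immediate. The one parameter e bounds both the weight and the distance
  from K, so the condition is monotone in e and e = 1/n suffices.\<close>

definition thin :: "real \<Rightarrow> (real \<Rightarrow> real) \<Rightarrow> (real \<Rightarrow> real) \<Rightarrow> bool" where
  "thin e g1 g2 \<longleftrightarrow> (\<exists>N::nat. \<exists>d. N > 0 \<and> d \<ge> 0 \<and> real N * d powr \<beta> \<le> e \<and>
     (\<forall>x\<in>{a..b}. \<forall>y\<in>{a..b}. infdist x K \<ge> e \<longrightarrow> infdist y K \<ge> e \<longrightarrow> \<bar>x - y\<bar> \<le> (b - a) / real N \<longrightarrow>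
        \<bar>x - y\<bar> \<le> d \<and> \<bar>g1 x - g1 y\<bar> \<le> d \<and> \<bar>g2 x - g2 y\<bar> \<le> d))"

definition near :: "real \<Rightarrow> (real \<Rightarrow> real) \<Rightarrow> (real \<Rightarrow> real) \<Rightarrow> (real \<Rightarrow> real) \<Rightarrow> (real \<Rightarrow> real) \<Rightarrow> bool" where
  "near \<delta> g1 g2 h1 h2 \<longleftrightarrow> (\<forall>x\<in>{a..b}. \<bar>g1 x - h1 x\<bar> \<le> \<delta> \<and> \<bar>g2 x - h2 x\<bar> \<le> \<delta>)"

text \<open>Invariant under exchanging the two summands: halves are fixed by the exchange, and g2
  \<le> w says that the other width is nonnegative.\<close>

definition admissible :: "(real \<Rightarrow> real) \<Rightarrow> (real \<Rightarrow> real) \<Rightarrow> bool" where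
  "admissible g1 g2 \<longleftrightarrow> continuous_on {a..b} g1 \<and> continuous_on {a..b} g2 \<and>
     (\<forall>x\<in>{a..b}. x \<in> K \<longrightarrow> g1 x = l x / 2 \<and> g2 x = w x / 2) \<and> (\<forall>x\<in>{a..b}. 0 \<le> g2 x \<and> g2 x \<le> w x)"

lemma thin_mono: "thin e g1 g2 \<Longrightarrow> e \<le> e' \<Longrightarrow> thin e' g1 g2"
  unfolding thin_def by (meson order_trans)

lemma near_mono: "near \<delta> g1 g2 h1 h2 \<Longrightarrow> \<delta> \<le> \<delta>' \<Longrightarrow> near \<delta>' g1 g2 h1 h2"
  unfolding near_def by (meson order_trans)

lemma near_trans:
  assumes "near \<delta> f1 f2 g1 g2" "near \<delta>' g1 g2 h1 h2"
  shows "near (\<delta> + \<delta>') f1 f2 h1 h2"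
  unfolding near_def
proof
  fix x assume x: "x \<in> {a..b}"
  then have "\<bar>f1 x - g1 x\<bar> \<le> \<delta>" "\<bar>f2 x - g2 x\<bar> \<le> \<delta>" "\<bar>g1 x - h1 x\<bar> \<le> \<delta>'" "\<bar>g2 x - h2 x\<bar> \<le> \<delta>'"
    using assms by (auto simp: near_def)
  then show "\<bar>f1 x - h1 x\<bar> \<le> \<delta> + \<delta>' \<and> \<bar>f2 x - h2 x\<bar> \<le> \<delta> + \<delta>'" by linarith
qed

lemma near_reflect:
  "near \<delta> (\<lambda>x. l x - g1 x) (\<lambda>x. w x - g2 x) h1 h2 \<longleftrightarrow> near \<delta> g1 g2 (\<lambda>x. l x - h1 x) (\<lambda>x. w x - h2 x)"
proof -
  have "\<bar>u - s - t\<bar> = \<bar>s - (u - t)\<bar>" for u s t :: real by linarith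
  then show ?thesis by (simp add: near_def)
qed

lemma admissible_reflect:
  "admissible g1 g2 \<Longrightarrow> admissible (\<lambda>x. l x - g1 x) (\<lambda>x. w x - g2 x)"
  unfolding admissible_def using cont_l cont_w by (auto intro!: continuous_intros)

text \<open>Here \<beta> > 1 is decisive: the expression equals A powr \<beta> * real N powr (1 -
  \<beta>), which tends to 0.\<close>

lemma small_cover_number:
  assumes "A > 0" "e > 0"
  obtains N :: nat where "N > 0" "real N * (A / real N) powr \<beta> \<le> e"
proof -
  have "((\<lambda>n. real n powr (1 - \<beta>)) \<longlongrightarrow> 0) sequentially"
    using \<beta> by (intro tendsto_neg_powr filterlim_real_sequentially) auto
  then have "(\<lambda>n. A powr \<beta> * real n powr (1 - \<beta>)) \<longlonglongrightarrow> A powr \<beta> * 0" by (intro tendsto_intros)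
  then have "\<forall>\<^sub>F n in sequentially. A powr \<beta> * real n powr (1 - \<beta>) < e"
    using assms(2) by (intro order_tendstoD(2)) auto
  then have "\<forall>\<^sub>F n in sequentially. A powr \<beta> * real n powr (1 - \<beta>) < e \<and> n > 0"
    by (intro eventually_conj eventually_gt_at_top)
  then obtain N where N: "A powr \<beta> * real N powr (1 - \<beta>) < e" "N > 0"
    unfolding eventually_sequentially by blast
  have "real N * (A / real N) powr \<beta> = A powr \<beta> * real N powr (1 - \<beta>)"
    using N(2) assms(1) by (simp add: powr_divide powr_diff)
  then show thesis using that[of N] N by simp
qed

text \<open>Density and openness in one: arbitrarily close to an admissible pair there is an
  admissible centre with a whole ball of thin pairs around it.\<close>

lemma exists_thin_neighbourhood:
  assumes adm: "admissible G1 G2" and pos: "\<delta> > 0" "e > 0"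
  obtains H1 H2 \<delta>' where "\<delta>' > 0" "admissible H1 H2" "near \<delta> H1 H2 G1 G2"
    "\<And>g1 g2. near \<delta>' g1 g2 H1 H2 \<Longrightarrow> thin e g1 g2"
proof -
  define \<epsilon> where "\<epsilon> = min \<delta> e"
  have \<epsilon>: "\<epsilon> > 0" "\<epsilon> \<le> \<delta>" "\<epsilon> \<le> e" using pos by (auto simp: \<epsilon>_def)
  have cont: "continuous_on {a..b} G1" "continuous_on {a..b} G2" using adm by (auto simp: admissible_def)
  obtain H1 L1 where H1: "L1 \<ge> 0" "continuous_on {a..b} H1"
    "\<And>x. x \<in> {a..b} \<Longrightarrow> H1 x \<le> G1 x" "\<And>x. x \<in> {a..b} \<Longrightarrow> G1 x - \<epsilon> \<le> H1 x"
    "\<And>x. x \<in> {a..b} \<Longrightarrow> x \<in> K \<Longrightarrow> H1 x = G1 x"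
    "\<And>x y. x \<in> {a..b} \<Longrightarrow> y \<in> {a..b} \<Longrightarrow> infdist x K \<ge> \<epsilon> \<Longrightarrow> infdist y K \<ge> \<epsilon> \<Longrightarrow> \<bar>H1 x - H1 y\<bar> \<le> L1 * \<bar>x - y\<bar>"
    by (rule Lipschitz_approx_off[OF less_imp_le[OF ab] cont(1) \<epsilon>(1), of K]) (rule that)
  obtain H2 L2 where H2: "L2 \<ge> 0" "continuous_on {a..b} H2"
    "\<And>x. x \<in> {a..b} \<Longrightarrow> H2 x \<le> G2 x" "\<And>x. x \<in> {a..b} \<Longrightarrow> G2 x - \<epsilon> \<le> H2 x"
    "\<And>x. x \<in> {a..b} \<Longrightarrow> x \<in> K \<Longrightarrow> H2 x = G2 x"
    "\<And>x y. x \<in> {a..b} \<Longrightarrow> y \<in> {a..b} \<Longrightarrow> infdist x K \<ge> \<epsilon> \<Longrightarrow> infdist y K \<ge> \<epsilon> \<Longrightarrow> \<bar>H2 x - H2 y\<bar> \<le> L2 * \<bar>x - y\<bar>"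
    "\<And>x. (\<forall>x\<in>{a..b}. 0 \<le> G2 x) \<Longrightarrow> 0 \<le> H2 x"
    by (rule Lipschitz_approx_off[OF less_imp_le[OF ab] cont(2) \<epsilon>(1), of K]) (rule that)
  define D where "D = (1 + L1 + L2) * (b - a)"
  have D: "D > 0" using H1(1) H2(1) ab by (simp add: D_def)
  \<comment> \<open>Over a distance of (b - a) / N the identity, H1 and H2 vary by at most \<delta>'
    = D / N away from K; a perturbation by \<delta>' at both points makes this 3 *
    \<delta>'.\<close>
  obtain N :: nat where N: "N > 0" "real N * (3 * D / real N) powr \<beta> \<le> e"
    using small_cover_number[of "3 * D" e] D pos(2) by auto
  define \<delta>' where "\<delta>' = D / real N"
  have \<delta>': "\<delta>' > 0" using D N(1) by (simp add: \<delta>'_def)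
  show thesis
  proof (rule that[OF \<delta>'])
    show "admissible H1 H2"
      unfolding admissible_def
    proof (intro conjI ballI)
      fix x assume x: "x \<in> {a..b}"
      show "x \<in> K \<longrightarrow> H1 x = l x / 2 \<and> H2 x = w x / 2"
        using adm H1(5) H2(5) x by (simp add: admissible_def)
      show "0 \<le> H2 x" using adm H2(7) by (simp add: admissible_def)
      show "H2 x \<le> w x" using adm H2(3)[OF x] x by (force simp: admissible_def)
    qed (rule H1(2), rule H2(2))
    show "near \<delta> H1 H2 G1 G2"
      unfolding near_def
    proof
      fix x assume "x \<in> {a..b}"
      then show "\<bar>H1 x - G1 x\<bar> \<le> \<delta> \<and> \<bar>H2 x - G2 x\<bar> \<le> \<delta>"
        using H1(3,4)[of x] H2(3,4)[of x] \<epsilon>(2) by linarith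
    qed
    fix g1 g2 assume near: "near \<delta>' g1 g2 H1 H2"
    have "\<bar>x - y\<bar> \<le> 3 * \<delta>' \<and> \<bar>g1 x - g1 y\<bar> \<le> 3 * \<delta>' \<and> \<bar>g2 x - g2 y\<bar> \<le> 3 * \<delta>'"
      if xy: "x \<in> {a..b}" "y \<in> {a..b}" "infdist x K \<ge> e" "infdist y K \<ge> e" "\<bar>x - y\<bar> \<le> (b - a) / real N" for x y
    proof -
      have far: "infdist x K \<ge> \<epsilon>" "infdist y K \<ge> \<epsilon>" using xy \<epsilon>(3) by auto
      have M: "M * \<bar>x - y\<bar> \<le> \<delta>'" if "0 \<le> M" "M \<le> 1 + L1 + L2" for M
      proof -
        have "M * \<bar>x - y\<bar> \<le> (1 + L1 + L2) * ((b - a) / real N)"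
          using that xy(5) by (intro mult_mono) auto
        then show ?thesis by (simp add: \<delta>'_def D_def)
      qed
      have "\<bar>H1 x - H1 y\<bar> \<le> \<delta>'" using H1(6)[OF xy(1,2) far] M[of L1] H1(1) H2(1) by linarith
      moreover have "\<bar>H2 x - H2 y\<bar> \<le> \<delta>'" using H2(6)[OF xy(1,2) far] M[of L2] H1(1) H2(1) by linarith
      moreover have "\<bar>x - y\<bar> \<le> \<delta>'" using M[of 1] H1(1) H2(1) by simp
      moreover have "\<bar>g1 x - H1 x\<bar> \<le> \<delta>'" "\<bar>g1 y - H1 y\<bar> \<le> \<delta>'" "\<bar>g2 x - H2 x\<bar> \<le> \<delta>'" "\<bar>g2 y - H2 y\<bar> \<le> \<delta>'"
        using near xy(1,2) by (auto simp: near_def)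
      ultimately show ?thesis using \<delta>' by linarith
    qed
    moreover have "real N * (3 * \<delta>') powr \<beta> \<le> e" using N(2) by (simp add: \<delta>'_def)
    ultimately show "thin e g1 g2" unfolding thin_def using N(1) \<delta>'
      by (intro exI[of _ N] exI[of _ "3 * \<delta>'"]) auto
  qed
qed

text \<open>One summand is made thin first; the other is then made thin by a move \<delta>2 so small
  that the first stays inside its ball. The radius 2 * \<delta>' leaves room for all later moves,
  which total at most \<delta>' + \<delta>'/2 + ... .\<close>

lemma exists_thin_neighbourhood_both:
  assumes adm: "admissible G1 G2" and pos: "\<delta> > 0" "e > 0"
  obtains H1 H2 \<delta>' where "\<delta>' > 0" "\<delta>' \<le> \<delta> / 2" "admissible H1 H2" "near \<delta> H1 H2 G1 G2"
    "\<And>g1 g2. near (2 * \<delta>') g1 g2 H1 H2 \<Longrightarrow> thin e g1 g2 \<and> thin e (\<lambda>x. l x - g1 x) (\<lambda>x. w x - g2 x)"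
proof -
  have "\<delta> / 2 > 0" using pos by simp
  then obtain A1 A2 \<delta>1 where A: "\<delta>1 > 0" "admissible A1 A2" "near (\<delta> / 2) A1 A2 G1 G2"
    "\<And>g1 g2. near \<delta>1 g1 g2 A1 A2 \<Longrightarrow> thin e g1 g2"
    by (rule exists_thin_neighbourhood[OF adm _ pos(2)]) (rule that)
  define \<delta>2 where "\<delta>2 = min (\<delta> / 2) (\<delta>1 / 2)"
  have \<delta>2: "\<delta>2 > 0" using pos(1) A(1) by (simp add: \<delta>2_def)
  obtain B1 B2 \<delta>3 where B: "\<delta>3 > 0" "admissible B1 B2" "near \<delta>2 B1 B2 (\<lambda>x. l x - A1 x) (\<lambda>x. w x - A2 x)"
    "\<And>g1 g2. near \<delta>3 g1 g2 B1 B2 \<Longrightarrow> thin e g1 g2"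
    by (rule exists_thin_neighbourhood[OF admissible_reflect[OF A(2)] \<delta>2 pos(2)]) (rule that)
  define H1 where "H1 x = l x - B1 x" for x
  define H2 where "H2 x = w x - B2 x" for x
  \<comment> \<open>2 * \<delta>' + \<delta>2 \<le> \<delta>1 keeps the first summand thin, 2 *
    \<delta>' \<le> \<delta>3 the second.\<close>
  define \<delta>' where "\<delta>' = min (\<delta> / 2) (min (\<delta>1 / 4) (\<delta>3 / 2))"
  have HA: "near \<delta>2 H1 H2 A1 A2" using B(3) unfolding H1_def H2_def near_reflect .
  show thesis
  proof (rule that[of \<delta>' H1 H2])
    show "\<delta>' > 0" "\<delta>' \<le> \<delta> / 2" using pos(1) A(1) B(1) by (auto simp: \<delta>'_def)
    show "admissible H1 H2" unfolding H1_def H2_def by (rule admissible_reflect[OF B(2)])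
    show "near \<delta> H1 H2 G1 G2"
      by (rule near_mono[OF near_trans[OF HA A(3)]]) (simp add: \<delta>2_def)
    fix g1 g2 assume g: "near (2 * \<delta>') g1 g2 H1 H2"
    have "thin e g1 g2"
      by (rule A(4), rule near_mono[OF near_trans[OF g HA]]) (simp add: \<delta>'_def \<delta>2_def min_def)
    moreover have "near \<delta>3 (\<lambda>x. l x - g1 x) (\<lambda>x. w x - g2 x) B1 B2"
      unfolding near_reflect by (rule near_mono[OF g[unfolded H1_def H2_def]]) (simp add: \<delta>'_def)
    ultimately show "thin e g1 g2 \<and> thin e (\<lambda>x. l x - g1 x) (\<lambda>x. w x - g2 x)" using B(4) by blast
  qed
qed

lemma exists_thin_splitting:
  obtains g1 g2 where "admissible g1 g2" "\<And>e. e > 0 \<Longrightarrow> thin e g1 g2"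
    "\<And>e. e > 0 \<Longrightarrow> thin e (\<lambda>x. l x - g1 x) (\<lambda>x. w x - g2 x)"
proof -
  define good where "good n G1 G2 \<delta> \<longleftrightarrow> \<delta> > 0 \<and> admissible G1 G2 \<and> (\<forall>g1 g2. near (2 * \<delta>) g1 g2 G1 G2 \<longrightarrow>
      thin (1 / real (Suc n)) g1 g2 \<and> thin (1 / real (Suc n)) (\<lambda>x. l x - g1 x) (\<lambda>x. w x - g2 x))"
    for n G1 G2 and \<delta> :: real
  define P where "P n t = (case t of (G1, G2, \<delta>) \<Rightarrow> good n G1 G2 \<delta>)" for n t
  define Q where "Q n t t' = (case t of (G1, G2, \<delta>) \<Rightarrow> case t' of (H1, H2, \<delta>') \<Rightarrow>
      near \<delta> H1 H2 G1 G2 \<and> \<delta>' \<le> \<delta> / 2)" for n :: nat and t t'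
  have step: "\<exists>H1 H2 \<delta>'. good n H1 H2 \<delta>' \<and> near \<delta> H1 H2 G1 G2 \<and> \<delta>' \<le> \<delta> / 2"
    if "admissible G1 G2" "\<delta> > 0" for n G1 G2 \<delta>
    unfolding good_def
    by (rule exists_thin_neighbourhood_both[OF that, of "1 / real (Suc n)"]) (simp, blast)
  have "admissible (\<lambda>x. l x / 2) (\<lambda>x. w x / 2)"
    unfolding admissible_def using cont_l cont_w w_nonneg by (auto intro!: continuous_intros)
  then have base: "\<exists>t. P 0 t" using step[of _ _ 1 0] unfolding P_def by fastforce
  have ind: "\<exists>t'. P (Suc n) t' \<and> Q n t t'" if "P n t" for n t
  proof -
    obtain G1 G2 \<delta> where t: "t = (G1, G2, \<delta>)" by (cases t)
    then have "admissible G1 G2" "\<delta> > 0" using that by (auto simp: P_def good_def)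
    from step[OF this, of "Suc n"] show ?thesis unfolding P_def Q_def t by auto
  qed
  obtain t where t: "\<And>n. P n (t n)" "\<And>n. Q n (t n) (t (Suc n))"
    using dependent_nat_choice[of P Q] base ind by blast
  define G1 where "G1 n = fst (t n)" for n
  define G2 where "G2 n = fst (snd (t n))" for n
  define \<delta> where "\<delta> n = snd (snd (t n))" for n
  have t_eq: "t n = (G1 n, G2 n, \<delta> n)" for n by (simp add: G1_def G2_def \<delta>_def)
  have good: "good n (G1 n) (G2 n) (\<delta> n)" for n using t(1)[of n] unfolding P_def t_eq by simp
  have next_near: "near (\<delta> n) (G1 (Suc n)) (G2 (Suc n)) (G1 n) (G2 n)" and \<delta>_half: "\<delta> (Suc n) \<le> \<delta> n / 2" for n
    using t(2)[of n] unfolding Q_def t_eq by auto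
  have \<delta>_pos: "\<delta> n > 0" and adm: "admissible (G1 n) (G2 n)" for n using good[of n] by (auto simp: good_def)
  \<comment> \<open>The subtracted term makes the induction work: the next move \<delta> (n + j) is
    paid for by 2 * \<delta> (n + j + 1) \<le> \<delta> (n + j).\<close>
  have close: "near (2 * \<delta> n - 2 * \<delta> (n + j)) (G1 (n + j)) (G2 (n + j)) (G1 n) (G2 n)" for n j
  proof (induction j)
    case 0
    then show ?case by (simp add: near_def)
  next
    case (Suc j)
    show ?case using near_mono[OF near_trans[OF next_near[of "n + j"] Suc]] \<delta>_half[of "n + j"] by simp
  qed
  have \<delta>_le: "\<delta> n \<le> \<delta> 0 * (1/2)^n" for n
  proof (induction n)
    case (Suc n)
    then show ?case using \<delta>_half[of n] by simp
  qed simp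
  have \<delta>_lim: "(\<lambda>n. 2 * \<delta> n) \<longlonglongrightarrow> 0"
  proof (rule tendsto_sandwich[of "\<lambda>_. 0" "\<lambda>n. 2 * \<delta> n" sequentially "\<lambda>n. 2 * (\<delta> 0 * (1/2)^n)"])
    have "(\<lambda>n. 2 * (\<delta> 0 * (1/2)^n)) \<longlonglongrightarrow> 2 * (\<delta> 0 * 0)" by (intro tendsto_intros LIMSEQ_power_zero) auto
    then show "(\<lambda>n. 2 * (\<delta> 0 * (1/2)^n)) \<longlonglongrightarrow> 0" by simp
    show "(\<lambda>n. 0::real) \<longlonglongrightarrow> 0" by simp
  qed (use \<delta>_pos \<delta>_le in \<open>auto simp: less_imp_le\<close>)
  have close1: "\<bar>G1 (n + j) x - G1 n x\<bar> \<le> 2 * \<delta> n" and close2: "\<bar>G2 (n + j) x - G2 n x\<bar> \<le> 2 * \<delta> n"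
    if "x \<in> {a..b}" for n j x
    using close[of n j] that \<delta>_pos[of "n + j"] unfolding near_def by fastforce+
  obtain g1 where g1: "continuous_on {a..b} g1" "\<And>x. x \<in> {a..b} \<Longrightarrow> (\<lambda>n. G1 n x) \<longlonglongrightarrow> g1 x"
    "\<And>n x. x \<in> {a..b} \<Longrightarrow> \<bar>g1 x - G1 n x\<bar> \<le> 2 * \<delta> n"
    by (rule uniform_Cauchy_limit[of "{a..b}" G1, OF _ \<delta>_lim close1]) (use adm that in \<open>auto simp: admissible_def\<close>)
  obtain g2 where g2: "continuous_on {a..b} g2" "\<And>x. x \<in> {a..b} \<Longrightarrow> (\<lambda>n. G2 n x) \<longlonglongrightarrow> g2 x"
    "\<And>n x. x \<in> {a..b} \<Longrightarrow> \<bar>g2 x - G2 n x\<bar> \<le> 2 * \<delta> n"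
    by (rule uniform_Cauchy_limit[of "{a..b}" G2, OF _ \<delta>_lim close2]) (use adm that in \<open>auto simp: admissible_def\<close>)
  have near_lim: "near (2 * \<delta> n) g1 g2 (G1 n) (G2 n)" for n using g1(3) g2(3) by (auto simp: near_def)
  have thin_n: "thin (1 / real (Suc n)) g1 g2" "thin (1 / real (Suc n)) (\<lambda>x. l x - g1 x) (\<lambda>x. w x - g2 x)" for n
    using good[of n] near_lim[of n] unfolding good_def by blast+
  show thesis
  proof (rule that[of g1 g2])
    have "g1 x = l x / 2 \<and> g2 x = w x / 2" if x: "x \<in> {a..b}" "x \<in> K" for x
    proof -
      have "(\<lambda>n. G1 n x) = (\<lambda>n. l x / 2)" "(\<lambda>n. G2 n x) = (\<lambda>n. w x / 2)"
        using adm x unfolding admissible_def by blast+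
      then show ?thesis using g1(2)[OF x(1)] g2(2)[OF x(1)] by (simp only: LIMSEQ_const_iff)
    qed
    moreover have "0 \<le> g2 x" "g2 x \<le> w x" if x: "x \<in> {a..b}" for x
    proof -
      have G: "0 \<le> G2 n x" "G2 n x \<le> w x" for n using adm[of n] x by (auto simp: admissible_def)
      show "0 \<le> g2 x" using G(1) by (intro LIMSEQ_le_const[OF g2(2)[OF x]]) auto
      show "g2 x \<le> w x" using G(2) by (intro LIMSEQ_le_const2[OF g2(2)[OF x]]) auto
    qed
    ultimately show "admissible g1 g2" using g1(1) g2(1) by (simp add: admissible_def)
    fix e :: real assume "e > 0"
    then obtain n where "1 / real (Suc n) < e" using nat_approx_posE by blast
    then show "thin e g1 g2" "thin e (\<lambda>x. l x - g1 x) (\<lambda>x. w x - g2 x)"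
      using thin_n[of n] thin_mono less_imp_le by blast+
  qed
qed

end

subsection \<open>Interval-valued functions\<close>

lemma infdist_interval:
  fixes x c d :: real
  assumes "c \<le> d"
  shows "infdist x {c..d} = max 0 (max (c - x) (x - d))"
proof -
  have ne: "{c..d} \<noteq> {}" using assms by simp
  have "infdist x {c..d} = (INF y\<in>{c..d}. dist x y)" using ne by (simp add: infdist_def)
  also have "\<dots> = max 0 (max (c - x) (x - d))"
  proof (rule cInf_eq_minimum)
    show "max 0 (max (c - x) (x - d)) \<in> dist x ` {c..d}"
      using assms by (intro image_eqI[of _ _ "max c (min d x)"]) (auto simp: dist_real_def)
  qed (auto simp: dist_real_def)
  finally show ?thesis .
qed

lemma hausdorff_dist_interval:
  assumes "a \<le> b" "c \<le> d"
  shows "hausdorff_dist {a..b} {c..d} = max \<bar>a - c\<bar> \<bar>b - d\<bar>"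
proof -
  \<comment> \<open>The distance to an interval is a convex function, so its maximum over {a..b} is
    attained at one of the two ends.\<close>
  have sup: "(SUP x\<in>{a..b}. infdist x {c..d}) = max 0 (max (c - a) (b - d))"
    if ab: "a \<le> b" "c \<le> d" for a b c d :: real
  proof (rule cSup_eq_maximum)
    show "max 0 (max (c - a) (b - d)) \<in> (\<lambda>x. infdist x {c..d}) ` {a..b}"
    proof (cases "c - a \<ge> b - d")
      case True
      then show ?thesis using ab by (intro image_eqI[of _ _ a]) (auto simp: infdist_interval)
    next
      case False
      then show ?thesis using ab by (intro image_eqI[of _ _ b]) (auto simp: infdist_interval)
    qed
  qed (use ab in \<open>auto simp: infdist_interval\<close>)
  show ?thesis unfolding hausdorff_dist_def sup[OF assms] sup[OF assms(2,1)] by linarith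
qed

lemma nearest_interval:
  assumes "c \<le> d"
  shows "nearest {c..d} x = {y \<in> {c..d}. \<bar>x - y\<bar> = max 0 (max (c - x) (x - d))}"
  using infdist_interval[OF assms, of x] assms
  by (simp add: nearest_def infdist_def dist_real_def)

text \<open>Given \<open>z\<close> in the Minkowski sum, the pair with sum \<open>z\<close> minimising the distance of its
  components is a metric pair.\<close>

lemma ksum_interval:
  assumes "a \<le> b" "c \<le> d"
  shows "ksum {a..b} {c..d} = {a + c..b + d}"
proof
  show "ksum {a..b} {c..d} \<subseteq> {a + c..b + d}" by (auto simp: ksum_def Lambda_pairs_def)
  show "{a + c..b + d} \<subseteq> ksum {a..b} {c..d}"
  proof
    fix z assume z: "z \<in> {a + c..b + d}"
    \<comment> \<open>This is z / 2 clamped to the x with x in {a..b} and z - x in {c..d}.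
      Unclamped, the components coincide; clamped, one of them is the end of its interval that faces
      the other component, hence nearest to it.\<close>
    define x where "x = max (max a (z - d)) (min (min b (z - c)) (z / 2))"
    have "x \<in> {a..b}" "z - x \<in> {c..d}"
      using z assms by (auto simp: x_def)
    moreover have "\<bar>(z - x) - x\<bar> = max 0 (max (a - (z - x)) ((z - x) - b)) \<or>
        \<bar>x - (z - x)\<bar> = max 0 (max (c - x) (x - d))"
      using z assms unfolding x_def atLeastAtMost_iff max_def min_def by (auto split: if_splits)
    ultimately have "(x, z - x) \<in> Lambda_pairs {a..b} {c..d}"
      unfolding Lambda_pairs_def nearest_interval[OF assms(1)] nearest_interval[OF assms(2)] by auto
    then show "z \<in> ksum {a..b} {c..d}" unfolding ksum_def
      by (intro CollectI exI[of _ x] exI[of _ "z - x"]) auto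
  qed
qed

lemma Kc_interval: "p \<le> q \<Longrightarrow> {p..q} \<in> Kc"
  by (auto simp: Kc_def)

lemma Kc_obtain_interval:
  assumes "A \<in> Kc"
  obtains p q where "p \<le> q" "A = {p..q}"
proof -
  have "connected A" "compact A" "A \<noteq> {}" using assms by (auto simp: Kc_def convex_connected)
  then show thesis using connected_compact_interval_1[of A] that by auto
qed

lemma graph_metric_interval:
  assumes "p \<le> q" "p' \<le> q'"
  shows "graph_metric (x, {p..q}) (y, {p'..q'}) = \<bar>x - y\<bar> + max \<bar>p - p'\<bar> \<bar>q - q'\<bar>"
  using assms by (simp add: graph_metric_def hausdorff_dist_interval)

lemma graph_star_image: "graph_star I g = (\<lambda>x. (x, g x)) ` I"
  by (auto simp: graph_star_def)

lemma cont_Kc_interval: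
  assumes "continuous_on I p" "continuous_on I q" "\<And>x. x \<in> I \<Longrightarrow> p x \<le> q x"
  shows "cont_Kc I (\<lambda>x. {p x..q x})"
  unfolding cont_Kc_def
proof (intro conjI ballI allI impI)
  fix x assume "x \<in> I"
  then show "{p x..q x} \<in> Kc" using assms(3) Kc_interval by blast
next
  fix x and e :: real assume x: "x \<in> I" and e: "e > 0"
  obtain d1 where d1: "d1 > 0" "\<And>y. y \<in> I \<Longrightarrow> \<bar>y - x\<bar> < d1 \<Longrightarrow> \<bar>p y - p x\<bar> < e"
    using assms(1) x e unfolding continuous_on_iff dist_real_def by meson
  obtain d2 where d2: "d2 > 0" "\<And>y. y \<in> I \<Longrightarrow> \<bar>y - x\<bar> < d2 \<Longrightarrow> \<bar>q y - q x\<bar> < e"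
    using assms(2) x e unfolding continuous_on_iff dist_real_def by meson
  show "\<exists>d>0. \<forall>y\<in>I. \<bar>y - x\<bar> < d \<longrightarrow> hausdorff_dist {p y..q y} {p x..q x} < e"
    using d1 d2 x assms(3) by (intro exI[of _ "min d1 d2"]) (auto simp: hausdorff_dist_interval)
qed

lemma cont_Kc_obtain_endpoints:
  assumes "cont_Kc I f"
  obtains p q where "continuous_on I p" "continuous_on I q" "\<And>x. x \<in> I \<Longrightarrow> p x \<le> q x"
    "\<And>x. x \<in> I \<Longrightarrow> f x = {p x..q x}"
proof -
  have "\<forall>x. \<exists>p q. x \<in> I \<longrightarrow> p \<le> q \<and> f x = {p..q}"
    using assms Kc_obtain_interval unfolding cont_Kc_def by metis
  then obtain p q where pq: "\<And>x. x \<in> I \<Longrightarrow> p x \<le> q x" "\<And>x. x \<in> I \<Longrightarrow> f x = {p x..q x}" by metis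
  have "\<exists>d>0. \<forall>y\<in>I. \<bar>y - x\<bar> < d \<longrightarrow> \<bar>p y - p x\<bar> < e \<and> \<bar>q y - q x\<bar> < e"
    if x: "x \<in> I" and e: "e > 0" for x e
  proof -
    obtain d where d: "d > 0" "\<And>y. y \<in> I \<Longrightarrow> \<bar>y - x\<bar> < d \<Longrightarrow> hausdorff_dist (f y) (f x) < e"
      using assms x e unfolding cont_Kc_def by blast
    have "\<bar>p y - p x\<bar> < e \<and> \<bar>q y - q x\<bar> < e" if "y \<in> I" "\<bar>y - x\<bar> < d" for y
      using d(2)[OF that] pq x that(1) by (simp add: hausdorff_dist_interval)
    then show ?thesis using d(1) by blast
  qed
  then have "continuous_on I p" "continuous_on I q"
    unfolding continuous_on_iff dist_real_def by meson+
  then show thesis using that pq by blast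
qed

section \<open>The dimension of a thin summand\<close>

context splitting
begin

lemma graph_null_off:
  assumes thin: "\<And>e. e > 0 \<Longrightarrow> thin e g1 g2" and nonneg: "\<And>x. x \<in> {a..b} \<Longrightarrow> 0 \<le> g2 x" and \<rho>: "\<rho> > 0"
  shows "hausdorff_measure graph_metric \<beta> (graph_star {x \<in> {a..b}. infdist x K \<ge> \<rho>} (\<lambda>x. {g1 x..g1 x + g2 x})) = 0"
proof (rule hausdorff_measure_eq_0I_finite)
  show "\<beta> > 0" using \<beta> by simp
  fix e :: real assume e: "e > 0"
  \<comment> \<open>e' \<le> \<rho> lets thinness apply to the whole set. The factor 2 pays for N +
    1 \<le> 2 * N cells, and 3 powr \<beta> for the diameter 3 * d: d from x and 2 * d from the
    right endpoint g1 + g2.\<close>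
  define e' where "e' = min \<rho> (e / (2 * 3 powr \<beta>))"
  have e': "e' > 0" "e' \<le> \<rho>" "e' \<le> e / (2 * 3 powr \<beta>)" using e \<rho> by (auto simp: e'_def)
  obtain N :: nat and d where N: "N > 0" "d \<ge> 0" "real N * d powr \<beta> \<le> e'" and
    d: "\<And>x y. x \<in> {a..b} \<Longrightarrow> y \<in> {a..b} \<Longrightarrow> infdist x K \<ge> e' \<Longrightarrow> infdist y K \<ge> e' \<Longrightarrow> \<bar>x - y\<bar> \<le> (b - a) / real N \<Longrightarrow>
        \<bar>x - y\<bar> \<le> d \<and> \<bar>g1 x - g1 y\<bar> \<le> d \<and> \<bar>g2 x - g2 y\<bar> \<le> d"
    using thin[OF e'(1)] unfolding thin_def by blast
  define A where "A = {x \<in> {a..b}. infdist x K \<ge> \<rho>}"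
  define g where "g x = {g1 x..g1 x + g2 x}" for x
  \<comment> \<open>The integer part is the cell index; x = b has index N, hence N + 1
    cells.\<close>
  define pos where "pos x = (x - a) * real N / (b - a)" for x
  define U where "U j = graph_star {x \<in> A. nat \<lfloor>pos x\<rfloor> = j} g" for j
  have pos: "0 \<le> pos x" "pos x \<le> real N" if "x \<in> A" for x
    using that ab unfolding A_def pos_def by (auto simp: field_simps intro!: divide_nonneg_pos mult_right_mono)
  have cover: "graph_star A g \<subseteq> (\<Union>j\<in>{..N}. U j)"
  proof
    fix z assume "z \<in> graph_star A g"
    then obtain x where x: "x \<in> A" "z = (x, g x)" by (auto simp: graph_star_def)
    have "nat \<lfloor>pos x\<rfloor> \<le> N" using pos[OF x(1)] by linarith
    then show "z \<in> (\<Union>j\<in>{..N}. U j)" using x by (auto simp: U_def graph_star_def)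
  qed
  have diam: "graph_metric z z' \<le> 3 * d" if zz: "z \<in> U j" "z' \<in> U j" for z z' j
  proof -
    obtain x where x: "x \<in> A" "nat \<lfloor>pos x\<rfloor> = j" "z = (x, g x)" using zz by (auto simp: U_def graph_star_def)
    obtain y where y: "y \<in> A" "nat \<lfloor>pos y\<rfloor> = j" "z' = (y, g y)" using zz by (auto simp: U_def graph_star_def)
    have "\<bar>pos x - pos y\<bar> \<le> 1" using x(2) y(2) pos[OF x(1)] pos[OF y(1)] by linarith
    also have "pos x - pos y = (x - y) * (real N / (b - a))" by (simp add: pos_def field_simps diff_divide_distrib)
    finally have "\<bar>x - y\<bar> * (real N / (b - a)) \<le> 1" using ab by (simp add: abs_mult)
    then have "\<bar>x - y\<bar> \<le> (b - a) / real N" using ab N(1) by (simp add: field_simps)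
    then have xyd: "\<bar>x - y\<bar> \<le> d \<and> \<bar>g1 x - g1 y\<bar> \<le> d \<and> \<bar>g2 x - g2 y\<bar> \<le> d"
      using x(1) y(1) e'(2) by (intro d) (auto simp: A_def)
    have "graph_metric z z' = \<bar>x - y\<bar> + max \<bar>g1 x - g1 y\<bar> \<bar>g1 x + g2 x - (g1 y + g2 y)\<bar>"
      unfolding x(3) y(3) g_def using x(1) y(1) nonneg by (intro graph_metric_interval) (auto simp: A_def)
    also have "\<dots> \<le> 3 * d" using xyd by linarith
    finally show ?thesis .
  qed
  have "(\<Sum>j\<in>{..N}. (3 * d) powr \<beta>) \<le> e"
  proof -
    have "(\<Sum>j\<in>{..N}. (3 * d) powr \<beta>) = (1 + real N) * (3 * d) powr \<beta>" by simp
    also have "\<dots> \<le> (2 * real N) * (3 * d) powr \<beta>" using N(1) by (intro mult_right_mono) auto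
    also have "\<dots> = 2 * 3 powr \<beta> * (real N * d powr \<beta>)" using N(2) by (simp add: powr_mult)
    also have "\<dots> \<le> 2 * 3 powr \<beta> * (e / (2 * 3 powr \<beta>))" using N(3) e'(3) by (intro mult_left_mono) auto
    also have "\<dots> = e" by simp
    finally show ?thesis .
  qed
  then show "\<exists>(J::nat set) U w. finite J \<and>
      graph_star {x \<in> {a..b}. infdist x K \<ge> \<rho>} (\<lambda>x. {g1 x..g1 x + g2 x}) \<subseteq> (\<Union>j\<in>J. U j) \<and> (\<forall>j\<in>J. w j \<ge> 0) \<and>
      (\<forall>j\<in>J. \<forall>x\<in>U j. \<forall>y\<in>U j. graph_metric x y \<le> w j) \<and> (\<Sum>j\<in>J. w j powr \<beta>) \<le> e"
    using cover diam N(2) unfolding A_def g_def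
    by (intro exI[of _ "{..N}"] exI[of _ U] exI[of _ "\<lambda>_. 3 * d"]) auto
qed

text \<open>Over K the graph is a bi-Lipschitz copy of that of f, which gives the lower bound. The
  remainder is a countable union of null pieces at distance at least 1/(n+1) from K and does not
  raise the dimension.\<close>

lemma admissible_thin_in_D_beta:
  assumes K: "K \<subseteq> {a..b}" "closed K" "K \<noteq> {}"
    and up: "\<And>s. s > \<beta> \<Longrightarrow> hausdorff_measure graph_metric s (graph_star K (\<lambda>x. {l x..l x + w x})) = 0"
    and low: "\<And>s. 0 < s \<Longrightarrow> s < \<beta> \<Longrightarrow> hausdorff_measure graph_metric s (graph_star K (\<lambda>x. {l x..l x + w x})) \<noteq> 0"
    and adm: "admissible g1 g2" and thin: "\<And>e. e > 0 \<Longrightarrow> thin e g1 g2"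
  shows "(\<lambda>x. {g1 x..g1 x + g2 x}) \<in> D_beta {a..b} \<beta>"
proof -
  define g where "g x = {g1 x..g1 x + g2 x}" for x
  define f where "f x = {l x..l x + w x}" for x
  have nonneg: "0 \<le> g2 x" if "x \<in> {a..b}" for x using adm that by (auto simp: admissible_def)
  \<comment> \<open>Halving acts on the values but not on \<bar>x - y\<bar>, hence constants 1 and 2
    rather than an exact ratio.\<close>
  have fg: "graph_metric (x, g x) (y, g y) \<le> 1 * graph_metric (x, f x) (y, f y) \<and>
      graph_metric (x, f x) (y, f y) \<le> 2 * graph_metric (x, g x) (y, g y)" if xy: "x \<in> K" "y \<in> K" for x y
  proof -
    have I: "x \<in> {a..b}" "y \<in> {a..b}" using xy K(1) by auto
    then have eq: "g1 x = l x / 2" "g2 x = w x / 2" "g1 y = l y / 2" "g2 y = w y / 2"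
      using adm xy by (auto simp: admissible_def)
    have "graph_metric (x, g x) (y, g y) = \<bar>x - y\<bar> + max \<bar>l x / 2 - l y / 2\<bar> \<bar>l x / 2 + w x / 2 - (l y / 2 + w y / 2)\<bar>"
      unfolding g_def eq using w_nonneg I by (intro graph_metric_interval) auto
    moreover have "graph_metric (x, f x) (y, f y) = \<bar>x - y\<bar> + max \<bar>l x - l y\<bar> \<bar>l x + w x - (l y + w y)\<bar>"
      unfolding f_def using w_nonneg I by (intro graph_metric_interval) auto
    ultimately show ?thesis by linarith
  qed
  have to_g: "hausdorff_measure graph_metric s (graph_star K g) = 0"
    if "s > 0" "hausdorff_measure graph_metric s (graph_star K f) = 0" for s
  proof -
    have "hausdorff_measure graph_metric s ((\<lambda>p. (fst p, g (fst p))) ` graph_star K f) = 0"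
      by (rule hausdorff_measure_null_Lipschitz_image[OF that(1) _ that(2), of 1])
        (use fg in \<open>auto simp: graph_star_def\<close>)
    moreover have "(\<lambda>p. (fst p, g (fst p))) ` graph_star K f = graph_star K g"
      by (auto simp: graph_star_image image_image)
    ultimately show ?thesis by simp
  qed
  have to_f: "hausdorff_measure graph_metric s (graph_star K f) = 0"
    if "s > 0" "hausdorff_measure graph_metric s (graph_star K g) = 0" for s
  proof -
    have "hausdorff_measure graph_metric s ((\<lambda>p. (fst p, f (fst p))) ` graph_star K g) = 0"
      by (rule hausdorff_measure_null_Lipschitz_image[OF that(1) _ that(2), of 2])
        (use fg in \<open>auto simp: graph_star_def\<close>)
    moreover have "(\<lambda>p. (fst p, f (fst p))) ` graph_star K g = graph_star K f"
      by (auto simp: graph_star_image image_image)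
    ultimately show ?thesis by simp
  qed
  have "hausdorff_dim graph_metric (graph_star {a..b} g) = ereal \<beta>"
  proof (rule hausdorff_dim_eqI)
    show "\<beta> > 0" using \<beta> by simp
  next
    fix s assume s: "s > \<beta>"
    then have s0: "s > 0" using \<beta> by simp
    define A where "A n = {x \<in> {a..b}. infdist x K \<ge> 1 / real (Suc n)}" for n
    have "hausdorff_measure graph_metric s (graph_star (A n) g) = 0" for n
      unfolding A_def g_def
      by (rule hausdorff_measure_null_mono_exponent[OF _ _ graph_null_off[OF thin nonneg]]) (use s \<beta> in auto)
    then have "hausdorff_measure graph_metric s (\<Union>n. graph_star (A n) g) = 0"
      using s0 by (intro hausdorff_measure_null_UN)
    moreover have "hausdorff_measure graph_metric s (graph_star K g) = 0"
      using up[OF s] s0 by (intro to_g) (auto simp: f_def[abs_def])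
    ultimately have "hausdorff_measure graph_metric s (graph_star K g \<union> (\<Union>n. graph_star (A n) g)) = 0"
      using s0 by (intro hausdorff_measure_null_Un)
    moreover have "graph_star {a..b} g \<subseteq> graph_star K g \<union> (\<Union>n. graph_star (A n) g)"
    proof
      fix z assume "z \<in> graph_star {a..b} g"
      then obtain x where x: "x \<in> {a..b}" "z = (x, g x)" by (auto simp: graph_star_def)
      show "z \<in> graph_star K g \<union> (\<Union>n. graph_star (A n) g)"
      proof (cases "x \<in> K")
        case False
        then have "infdist x K > 0" using K(2,3) by (simp add: infdist_pos_not_in_closed)
        then obtain n where "1 / real (Suc n) < infdist x K" using nat_approx_posE by blast
        then have "x \<in> A n" using x(1) by (simp add: A_def)
        then show ?thesis using x(2) by (auto simp: graph_star_def)
      qed (use x in \<open>auto simp: graph_star_def\<close>)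
    qed
    ultimately show "hausdorff_measure graph_metric s (graph_star {a..b} g) = 0"
      by (rule hausdorff_measure_null_subset[rotated])
  next
    fix s assume s: "0 < s" "s < \<beta>"
    show "hausdorff_measure graph_metric s (graph_star {a..b} g) \<noteq> 0"
    proof
      assume "hausdorff_measure graph_metric s (graph_star {a..b} g) = 0"
      then have "hausdorff_measure graph_metric s (graph_star K g) = 0"
        by (rule hausdorff_measure_null_subset[rotated]) (use K(1) in \<open>auto simp: graph_star_def\<close>)
      then show False using to_f[OF s(1)] low[OF s] by (simp add: f_def[abs_def])
    qed
  qed
  moreover have "cont_Kc {a..b} g" unfolding g_def
    using adm nonneg by (intro cont_Kc_interval continuous_intros) (auto simp: admissible_def)
  ultimately show ?thesis by (simp add: D_beta_def g_def[abs_def])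
qed

end

lemma exact_dimension_graph_restriction:
  assumes \<beta>: "\<beta> > 0" and p: "continuous_on {a..b} p" and q: "continuous_on {a..b} q"
    and pq: "\<And>x. x \<in> {a..b} \<Longrightarrow> p x \<le> q x"
    and dim: "hausdorff_dim graph_metric (graph_star {a..b} (\<lambda>x. {p x..q x})) \<ge> ereal \<beta>"
  obtains K where "K \<subseteq> {a..b}" "closed K" "K \<noteq> {}"
    "\<And>s. s > \<beta> \<Longrightarrow> hausdorff_measure graph_metric s (graph_star K (\<lambda>x. {p x..q x})) = 0"
    "\<And>s. 0 < s \<Longrightarrow> s < \<beta> \<Longrightarrow> hausdorff_measure graph_metric s (graph_star K (\<lambda>x. {p x..q x})) \<noteq> 0"
proof -
  define f where "f x = {p x..q x}" for x
  have empty: "hausdorff_measure graph_metric s (graph_star {} f) = 0" if "s > 0" for s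
    by (rule hausdorff_measure_eq_0I[OF that], rule exI[of _ "\<lambda>_. {}"], rule exI[of _ "\<lambda>_. 0"])
      (auto simp: graph_star_def)
  show thesis
  \<comment> \<open>If the \<beta>-measure vanishes although the dimension is at least \<beta>, the
    whole interval already has exact dimension \<beta> and serves as K. The subset theorem handles
    the other case.\<close>
  proof (cases "hausdorff_measure graph_metric \<beta> (graph_star {a..b} f) = 0")
    case True
    have low: "hausdorff_measure graph_metric s (graph_star {a..b} f) \<noteq> 0" if s: "0 < s" "s < \<beta>" for s
    proof
      assume "hausdorff_measure graph_metric s (graph_star {a..b} f) = 0"
      then have "hausdorff_dim graph_metric (graph_star {a..b} f) \<le> ereal s"
        unfolding hausdorff_dim_def using s by (intro Inf_lower) auto
      then have "ereal \<beta> \<le> ereal s" using dim unfolding f_def by (rule order_trans[rotated])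
      then show False using s by simp
    qed
    have "{a..b} \<noteq> {}" using empty[of "\<beta> / 2"] low[of "\<beta> / 2"] \<beta> by force
    then show thesis
      using that[of "{a..b}"] low hausdorff_measure_null_mono_exponent[OF _ _ True] \<beta>
      unfolding f_def by force
  next
    case False
    \<comment> \<open>Coordinates x, p x and q x. The graph metric adds \<bar>x - y\<bar> to a
      maximum, so it lies between the sup distance of the coordinates and twice that
      distance.\<close>
    define F where "F i x = (if i = (1::3) then x else if i = 2 then p x else q x)" for i x
    have F: "F 1 = (\<lambda>x. x)" "F 2 = p" "F 3 = q" by (auto simp: F_def)
    have met: "graph_metric (x, f x) (y, f y) = \<bar>x - y\<bar> + max \<bar>p x - p y\<bar> \<bar>q x - q y\<bar>"
      if "x \<in> {a..b}" "y \<in> {a..b}" for x y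
      unfolding f_def using pq that by (intro graph_metric_interval) auto
    have contF: "continuous_on {a..b} (F i)" for i
      using p q exhaust_3[of i] by (auto simp: F continuous_on_id)
    have lowF: "\<bar>F i x - F i y\<bar> \<le> graph_metric (x, f x) (y, f y)" if "x \<in> {a..b}" "y \<in> {a..b}" for i x y
      unfolding met[OF that] using exhaust_3[of i] by (elim disjE) (simp_all add: F; linarith)+
    have upF: "graph_metric (x, f x) (y, f y) \<le> 2 * m"
      if "x \<in> {a..b}" "y \<in> {a..b}" "\<And>i. \<bar>F i x - F i y\<bar> \<le> m" for x y m
      unfolding met[OF that(1,2)] using that(3)[of 1] that(3)[of 2] that(3)[of 3] by (simp add: F)
    obtain K where K: "K \<subseteq> {a..b}" "closed K" "hausdorff_measure graph_metric \<beta> ((\<lambda>x. (x, f x)) ` K) \<noteq> 0"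
      "\<And>s. s > \<beta> \<Longrightarrow> hausdorff_measure graph_metric s ((\<lambda>x. (x, f x)) ` K) = 0"
    proof (rule exact_dimension_subset[of "{a..b}" F \<beta> 2 graph_metric "\<lambda>x. (x, f x)"])
      show "hausdorff_measure graph_metric \<beta> ((\<lambda>x. (x, f x)) ` {a..b}) \<noteq> 0"
        using False by (simp add: graph_star_image)
    qed (use contF \<beta> lowF upF that in auto)
    have "K \<noteq> {}" using K(3) empty[OF \<beta>] by (auto simp: graph_star_image)
    moreover have "hausdorff_measure graph_metric s (graph_star K f) \<noteq> 0" if "0 < s" "s < \<beta>" for s
      using K(3) hausdorff_measure_null_mono_exponent[of s \<beta> graph_metric "graph_star K f"] that
      by (auto simp: graph_star_image)
    ultimately show thesis
      using that[of K] K(1,2,4) unfolding f_def by (simp add: graph_star_image)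
  qed
qed

theorem theorem4p19:
  fixes a b \<beta> :: real and f :: "real \<Rightarrow> real set"
  assumes "a < b"
    and "\<beta> > 1"
    and "cont_Kc {a..b} f"
    and "hausdorff_dim graph_metric (graph_star {a..b} f) \<ge> ereal \<beta>"
  shows "\<exists>g h. g \<in> D_beta {a..b} \<beta> \<and> h \<in> D_beta {a..b} \<beta> \<and>
               (\<forall>x\<in>{a..b}. f x = ksum (g x) (h x))"
proof -
  obtain p q where pq: "continuous_on {a..b} p" "continuous_on {a..b} q"
    "\<And>x. x \<in> {a..b} \<Longrightarrow> p x \<le> q x" "\<And>x. x \<in> {a..b} \<Longrightarrow> f x = {p x..q x}"
    using cont_Kc_obtain_endpoints[OF assms(3)] by blast
  have "graph_star {a..b} f = graph_star {a..b} (\<lambda>x. {p x..q x})"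
    unfolding graph_star_image using pq(4) by (intro image_cong) auto
  then have dim: "hausdorff_dim graph_metric (graph_star {a..b} (\<lambda>x. {p x..q x})) \<ge> ereal \<beta>"
    using assms(4) by simp
  have "\<beta> > 0" using assms(2) by simp
  from exact_dimension_graph_restriction[OF this pq(1-3) dim]
  obtain K where K: "K \<subseteq> {a..b}" "closed K" "K \<noteq> {}"
    "\<And>s. s > \<beta> \<Longrightarrow> hausdorff_measure graph_metric s (graph_star K (\<lambda>x. {p x..q x})) = 0"
    "\<And>s. 0 < s \<Longrightarrow> s < \<beta> \<Longrightarrow> hausdorff_measure graph_metric s (graph_star K (\<lambda>x. {p x..q x})) \<noteq> 0"
    by blast
  define w where "w x = q x - p x" for x
  interpret splitting a b \<beta> K p w
    by unfold_locales (use assms pq in \<open>auto simp: w_def intro!: continuous_intros\<close>)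
  have pw: "(\<lambda>x. {p x..p x + w x}) = (\<lambda>x. {p x..q x})" by (simp add: w_def)
  obtain g1 g2 where g: "admissible g1 g2" "\<And>e. e > 0 \<Longrightarrow> thin e g1 g2"
    "\<And>e. e > 0 \<Longrightarrow> thin e (\<lambda>x. p x - g1 x) (\<lambda>x. w x - g2 x)"
    using exists_thin_splitting by blast
  define g where "g x = {g1 x..g1 x + g2 x}" for x
  define h where "h x = {p x - g1 x..p x - g1 x + (w x - g2 x)}" for x
  have "g \<in> D_beta {a..b} \<beta>"
    unfolding g_def using K g(1,2) by (intro admissible_thin_in_D_beta) (auto simp: pw)
  moreover have "h \<in> D_beta {a..b} \<beta>"
    unfolding h_def using K g(3) admissible_reflect[OF g(1)]
    by (intro admissible_thin_in_D_beta) (auto simp: pw)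
  moreover have "f x = ksum (g x) (h x)" if x: "x \<in> {a..b}" for x
  proof -
    have "0 \<le> g2 x" "g2 x \<le> w x" using g(1) x by (auto simp: admissible_def)
    then have "ksum (g x) (h x) = {g1 x + (p x - g1 x)..g1 x + g2 x + (p x - g1 x + (w x - g2 x))}"
      unfolding g_def h_def by (intro ksum_interval) auto
    then show ?thesis using pq(4)[OF x] by (simp add: w_def)
  qed
  ultimately show ?thesis by blast
qed

end
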